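(* Let $a=\frac{i}{2}\begin{pmatrix}I_k&0\\0&-I_{n-k}\end{pmatrix}$, and $M$ the adjoint $U(n)$-orbit at $a$ in $u(n)$ (which is the Grassmannian $Gr(k,n)$). Then the GNLS flow $\gamma_t=[\gamma,\gamma_{xx}]$ on $C_a(\mathbb{R},M)$ corresponds to the MNLS flow $u_t=(Q_2)_x+[u,Q_2]$ on $\mathcal{S}(\mathbb{R},u(n)_a^\perp)$ under the development map $\Phi$. That is, if $\gamma(x,t)$ solves $\gamma_t=[\gamma,\gamma_{xx}]$ with $\gamma(\cdot,t)\in C_a(\mathbb{R},M)$, then $u(\cdot,t)=\Phi(\gamma(\cdot,t))$ solves $u_t=(Q_2)_x+[u,Q_2]$.
   Context: $u(n)$ carries the invariant inner product $\langle x,y\rangle=-\mathrm{tr}(xy)$. $u(n)_a=\{y\in u(n): [y,a]=0\}$ is the centralizer of $a$ (block-diagonal matrices $\mathrm{diag}(A_1,A_2)$, $A_1\in u(k)$, $A_2\in u(n-k)$), and $u(n)_a^\perp=\left\{\begin{pmatrix}0&q\\-q^*&0\end{pmatrix}: q\in \mathcal{M}_{k\times(n-k)}\right\}$ is its orthogonal complement. $\mathcal{S}(\mathbb{R},u(n)_a^\perp)$ denotes Schwartz-class maps $\mathbb{R}\to u(n)_a^\perp$. $C_a(\mathbb{R},M)$ is the space of smooth paths $\gamma:\mathbb{R}\to M$ with $\lim_{x\to-\infty}\gamma(x)=a$ and $\gamma_x$ in the Schwartz class. The development map $\Phi:C_a(\mathbb{R},M)\to \mathcal{S}(\mathbb{R},u(n)_a^\perp)$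 is defined by $\Phi(\gamma)=g^{-1}g_x$, where $g:\mathbb{R}\to U(n)$ is the unique map with $\gamma=gag^{-1}$, $g(-\infty)=I$ and $g^{-1}g_x\in u(n)_a^\perp$; $\Phi$ is a bijection. In the MNLS equation, $u=\begin{pmatrix}0&q\\-q^*&0\end{pmatrix}$ and $Q_2=\begin{pmatrix}-iqq^*& iq_x\\ iq^*_x& iq^*q\end{pmatrix}$; written in $q$ it is $q_t=i(q_{xx}+2qq^*q)$. The equation $\gamma_t=[\gamma,\gamma_{xx}]$ is the geometric nonlinear Schrödinger equation $J_\gamma\gamma_t=\nabla_{\gamma_x}\gamma_x$ for $Gr(k,n)$ embedded as this adjoint orbit. *)

theory Defs
  imports "HOL-Analysis.Analysis"
begin

text \<open>Matrices of size n x n with n = k + (n-k) are indexed by the sum type 'k + 'm,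
  where CARD('k) = k and CARD('m) = n - k; Inl indices form the first block.\<close>

type_synonym ('k,'m) mat = "complex ^ ('k + 'm) ^ ('k + 'm)"

definition ctrans :: "complex ^ 'c ^ 'r \<Rightarrow> complex ^ 'r ^ 'c" where
  "ctrans A = (\<chi> i j. cnj (A $ j $ i))"

definition cscale :: "complex \<Rightarrow> complex ^ 'c ^ 'r \<Rightarrow> complex ^ 'c ^ 'r" where
  "cscale c A = (\<chi> i j. c * A $ i $ j)"

definition comm :: "complex ^ 'n ^ 'n \<Rightarrow> complex ^ 'n ^ 'n \<Rightarrow> complex ^ 'n ^ 'n" where
  "comm A B = A ** B - B ** A"

definition unitary :: "complex ^ 'n ^ 'n \<Rightarrow> bool" where
  "unitary U \<longleftrightarrow> U ** ctrans U = mat 1 \<and> ctrans U ** U = mat 1"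

definition blk :: "complex ^ 'k ^ 'k \<Rightarrow> complex ^ 'm ^ 'k \<Rightarrow> complex ^ 'k ^ 'm
     \<Rightarrow> complex ^ 'm ^ 'm \<Rightarrow> ('k,'m) mat" where
  "blk A B C D = (\<chi> i j. case (i, j) of
       (Inl r, Inl s) \<Rightarrow> A $ r $ s
     | (Inl r, Inr s) \<Rightarrow> B $ r $ s
     | (Inr r, Inl s) \<Rightarrow> C $ r $ s
     | (Inr r, Inr s) \<Rightarrow> D $ r $ s)"

definition ublk :: "('k,'m) mat \<Rightarrow> complex ^ 'm ^ 'k" where
  "ublk u = (\<chi> r s. u $ Inl r $ Inr s)"

definition a_pt :: "('k::finite,'m::finite) mat" where
  "a_pt = blk (cscale (\<i>/2) (mat 1)) 0 0 (cscale (-\<i>/2) (mat 1))"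

definition orbitM :: "('k::finite,'m::finite) mat set" where
  "orbitM = {g ** a_pt ** ctrans g | g. unitary g}"

definition u_perp :: "('k::finite,'m::finite) mat set" where
  "u_perp = {blk 0 q (-ctrans q) 0 | q. True}"

fun vderivs :: "nat \<Rightarrow> (real \<Rightarrow> 'a::real_normed_vector) \<Rightarrow> real \<Rightarrow> 'a" where
  "vderivs 0 f = f"
| "vderivs (Suc m) f = (\<lambda>x. vector_derivative (vderivs m f) (at x))"

definition smooth_fun :: "(real \<Rightarrow> 'a::real_normed_vector) \<Rightarrow> bool" where
  "smooth_fun f \<longleftrightarrow> (\<forall>m x. (vderivs m f has_vector_derivative vderivs (Suc m) f x) (at x))"

definition schwartz :: "(real \<Rightarrow> 'a::real_normed_vector) \<Rightarrow> bool" where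
  "schwartz f \<longleftrightarrow> smooth_fun f \<and>
     (\<forall>j m. \<exists>C. \<forall>x. \<bar>x\<bar> ^ j * norm (vderivs m f x) \<le> C)"

definition C_a :: "(real \<Rightarrow> ('k::finite,'m::finite) mat) set" where
  "C_a = {\<gamma>. smooth_fun \<gamma> \<and> (\<forall>x. \<gamma> x \<in> orbitM) \<and> (\<gamma> \<longlongrightarrow> a_pt) at_bot
            \<and> schwartz (vderivs 1 \<gamma>)}"

definition dev_frame :: "(real \<Rightarrow> ('k::finite,'m::finite) mat) \<Rightarrow> (real \<Rightarrow> ('k,'m) mat) \<Rightarrow> bool" where
  "dev_frame \<gamma> g \<longleftrightarrow> smooth_fun g \<and> (\<forall>x. unitary (g x))
     \<and> (\<forall>x. \<gamma> x = g x ** a_pt ** matrix_inv (g x)) \<and> (g \<longlongrightarrow> mat 1) at_bot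
     \<and> (\<forall>x. matrix_inv (g x) ** vderivs 1 g x \<in> u_perp)"

definition Phi :: "(real \<Rightarrow> ('k::finite,'m::finite) mat) \<Rightarrow> real \<Rightarrow> ('k,'m) mat" where
  "Phi \<gamma> = (THE u. \<exists>g. dev_frame \<gamma> g \<and> u = (\<lambda>x. matrix_inv (g x) ** vderivs 1 g x))"

definition Q2 :: "('k::finite,'m::finite) mat \<Rightarrow> ('k,'m) mat \<Rightarrow> ('k,'m) mat" where
  "Q2 u ux = (let q = ublk u; qx = ublk ux in
     blk (cscale (-\<i>) (q ** ctrans q)) (cscale \<i> qx) (cscale \<i> (ctrans qx)) (cscale \<i> (ctrans q ** q)))"

definition pd :: "nat \<Rightarrow> nat \<Rightarrow> (real \<Rightarrow> real \<Rightarrow> 'a::real_normed_vector) \<Rightarrow> real \<Rightarrow> real \<Rightarrow> 'a" where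
  "pd i j f x t = vderivs i (\<lambda>y. vderivs j (\<lambda>s. f y s) t) x"

definition smooth2 :: "(real \<Rightarrow> real \<Rightarrow> 'a::real_normed_vector) \<Rightarrow> bool" where
  "smooth2 f \<longleftrightarrow> (\<forall>i j.
      continuous_on UNIV (\<lambda>(x,t). pd i j f x t)
    \<and> (\<forall>x t. ((\<lambda>y. pd i j f y t) has_vector_derivative pd (Suc i) j f x t) (at x))
    \<and> (\<forall>x t. ((\<lambda>s. pd i j f x s) has_vector_derivative pd i (Suc j) f x t) (at t)))"

end

theory Submission
  imports Defs
begin

text \<open>
  Put \<open>A = 2 \<gamma> \<gamma>\<^sub>x = [\<gamma>, \<gamma>\<^sub>x]\<close>. The frame \<open>g\<close> of \<open>\<gamma>(\<cdot>, t)\<close> is the solution of the linear equation \<open>g\<^sub>x = A g\<close>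
  with \<open>g(-\<infinity>) = I\<close>, and \<open>u = g\<^sup>* A g\<close>. The flow makes \<open>A\<close> and \<open>B = 6 \<gamma> \<gamma>\<^sub>x\<^sup>2 - \<gamma>\<^sub>x\<^sub>x\<close> satisfy the
  zero curvature equation \<open>B\<^sub>x = A\<^sub>t + [A, B]\<close>, and \<open>Q\<^sub>2 = g\<^sup>* B g\<close>; so the MNLS equation follows once
  \<open>g\<^sub>t = B g\<close> is known.

  That last equation is delicate because \<open>g\<close> is normalised at \<open>-\<infinity>\<close>, while the decay of \<open>\<gamma>\<^sub>x\<close> is not assumed to be
  uniform in \<open>t\<close>. Parallel transport between finite points does satisfy the expected equation, and one may let one
  point tend to \<open>-\<infinity>\<close> as soon as the energy \<open>\<integral> |\<gamma>\<^sub>x|\<^sup>2\<close> near \<open>-\<infinity>\<close> is locally bounded in \<open>t\<close>. A bound for the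
  energy on a time interval, combined with the conservation law of momentum, shows that no energy enters from
  \<open>-\<infinity>\<close> during that interval; a Baire category argument then gives the local bound at every time.
\<close>

section \<open>Complex matrices\<close>

text \<open>Since \<open>\<gamma> ** \<gamma>\<close> is \<open>- (1/4)\<close> times the identity,
  \<open>\<gamma>\<close> and its x-derivative anticommute; this explains the factor 2 in
  \<open>A\<close> and why every identity of the flow is a computation with words in
  \<open>\<gamma>\<close> and its x-derivatives. The square |\<gamma>_x|^2 is the mass density of
  the Schroedinger equation. Its balance on [-y, 0] leaves the flux at -y, integrated over a time
  interval; at each fixed time this flux vanishes as y grows, but without uniformity in t the limit
  cannot be taken under the integral. The remedy is to apply conservation once more, to the flux
  itself: the time integral of the momentum flux has an x-derivative that involves only the two end
  times, where decay is available. Together with the energy bound this gives a differential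
  inequality in y that prevents the integrated flux from staying away from 0. Vanishing along some
  sequence is enough, because the energy on [-y, 0] grows with y. The size of the assumed bound
  drops out of the conclusion, and the category argument depends on that.\<close>

lemma inner_mat_eq:
  fixes X Y :: "complex ^ 'c ^ 'r"
  shows "X \<bullet> Y = Re (\<Sum>i\<in>UNIV. \<Sum>j\<in>UNIV. cnj (X$i$j) * Y$i$j)"
  by (simp add: inner_vec_def inner_complex_def)

lemma ctrans_nth [simp]: "ctrans A $ i $ j = cnj (A $ j $ i)"
  by (simp add: ctrans_def)

lemma ctrans_ctrans [simp]: "ctrans (ctrans A) = A"
  by (simp add: vec_eq_iff)

lemma ctrans_mult: "ctrans (A ** B) = ctrans B ** ctrans A"
  by (simp add: vec_eq_iff matrix_matrix_mult_def mult.commute)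

lemma ctrans_mat_1 [simp]: "ctrans (mat 1) = mat 1"
  by (simp add: vec_eq_iff mat_def)

lemma norm_ctrans [simp]: "norm (ctrans X) = norm X"
proof -
  have "ctrans X \<bullet> ctrans X = X \<bullet> X"
    unfolding inner_mat_eq by (subst sum.swap) (simp add: mult.commute)
  then show ?thesis by (simp add: norm_eq_sqrt_inner)
qed

lemma bounded_linear_ctrans: "bounded_linear ctrans"
proof (rule bounded_linear_intro[where K = 1])
  show "ctrans (x + y) = ctrans x + ctrans y" for x y :: "complex^'a^'b"
    by (simp add: vec_eq_iff)
  show "ctrans (r *\<^sub>R x) = r *\<^sub>R ctrans x" for r and x :: "complex^'a^'b"
    by (simp add: vec_eq_iff)
qed simp

lemmas ctrans_diff = bounded_linear.linear[OF bounded_linear_ctrans, THEN linear_diff]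
lemmas ctrans_scaleR = bounded_linear.linear[OF bounded_linear_ctrans, THEN linear_scale]

text \<open>Cauchy-Schwarz for each entry, after which the double sum factorises.\<close>

lemma norm_mat_mult_le:
  fixes X :: "complex ^ 'b ^ 'a" and Y :: "complex ^ 'c ^ 'b"
  shows "norm (X ** Y) \<le> norm X * norm Y"
proof -
  have sq: "(norm Z)\<^sup>2 = (\<Sum>i\<in>UNIV. \<Sum>j\<in>UNIV. (norm (Z$i$j))\<^sup>2)" for Z :: "complex ^ 'd ^ 'e"
    unfolding norm_vec_def L2_set_def by (simp add: sum_nonneg)
  have entry: "(norm ((X ** Y)$i$j))\<^sup>2 \<le> (\<Sum>k\<in>UNIV. (norm (X$i$k))\<^sup>2) * (\<Sum>k\<in>UNIV. (norm (Y$k$j))\<^sup>2)" for i j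
  proof -
    have "norm ((X ** Y)$i$j) \<le> (\<Sum>k\<in>UNIV. norm (X$i$k) * norm (Y$k$j))"
      unfolding matrix_matrix_mult_def by (simp, rule order.trans[OF norm_sum]) (simp add: norm_mult)
    then have "(norm ((X ** Y)$i$j))\<^sup>2 \<le> (\<Sum>k\<in>UNIV. norm (X$i$k) * norm (Y$k$j))\<^sup>2"
      by (simp add: power_mono)
    also have "\<dots> \<le> (\<Sum>k\<in>UNIV. (norm (X$i$k))\<^sup>2) * (\<Sum>k\<in>UNIV. (norm (Y$k$j))\<^sup>2)"
      by (rule Cauchy_Schwarz_ineq_sum)
    finally show ?thesis .
  qed
  have "(norm (X ** Y))\<^sup>2 \<le> (\<Sum>i\<in>UNIV. \<Sum>j\<in>UNIV. (\<Sum>k\<in>UNIV. (norm (X$i$k))\<^sup>2) * (\<Sum>k\<in>UNIV. (norm (Y$k$j))\<^sup>2))"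
    unfolding sq by (intro sum_mono entry)
  also have "\<dots> = (norm X)\<^sup>2 * (\<Sum>j\<in>UNIV. \<Sum>k\<in>UNIV. (norm (Y$k$j))\<^sup>2)"
    unfolding sq by (simp add: sum_product)
  also have "(\<Sum>j\<in>UNIV. \<Sum>k\<in>UNIV. (norm (Y$k$j))\<^sup>2) = (norm Y)\<^sup>2"
    unfolding sq by (rule sum.swap)
  finally show ?thesis
    by (simp add: power_mult_distrib[symmetric] power2_le_iff_abs_le)
qed

lemma scaleR_mat_mult_left: "(r *\<^sub>R X) ** Y = r *\<^sub>R (X ** (Y :: complex ^ 'c ^ 'b))"
  by (simp add: vec_eq_iff matrix_matrix_mult_def scaleR_sum_right)

lemma scaleR_mat_mult_right: "X ** (r *\<^sub>R Y) = r *\<^sub>R (X ** (Y :: complex ^ 'c ^ 'b))"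
  by (simp add: vec_eq_iff matrix_matrix_mult_def scaleR_sum_right)

interpretation mat_mult: bounded_bilinear
  "(**) :: complex ^ 'b ^ 'a \<Rightarrow> complex ^ 'c ^ 'b \<Rightarrow> complex ^ 'c ^ 'a"
proof
  show "\<exists>K. \<forall>a b. norm ((a:: complex ^ 'b ^ 'a) ** (b:: complex ^ 'c ^ 'b)) \<le> norm a * norm b * K"
    by (intro exI[of _ 1]) (simp add: norm_mat_mult_le)
qed (simp_all add: matrix_add_ldistrib scaleR_mat_mult_left scaleR_mat_mult_right,
    simp add: vec_eq_iff matrix_matrix_mult_def sum.distrib distrib_right)

lemmas mat_distribs =
  mat_mult.add_left mat_mult.add_right mat_mult.diff_left mat_mult.diff_right
  mat_mult.minus_left mat_mult.minus_right mat_mult.scaleR_left mat_mult.scaleR_right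
  mat_mult.zero_left mat_mult.zero_right
text \<open>Normal form of a matrix expression: real scalars outside, products nested to the right.
  Relations between two factors are applied inside longer words through
  \<open>mat_mult_assoc_subst\<close>.\<close>

lemmas mat_algebra = mat_distribs matrix_mul_assoc[symmetric]
  scaleR_add_right scaleR_diff_right

lemmas has_vector_derivative_mat_mult = mat_mult.has_vector_derivative
lemmas has_vector_derivative_ctrans = bounded_linear.has_vector_derivative[OF bounded_linear_ctrans]

text \<open>The real inner product is the real part of the trace of \<open>ctrans X ** Y\<close>.
  Moving a skew factor across it only changes the sign, which is the basic move behind the
  conservation laws.\<close>

lemma inner_mult_adjoint_left:
  fixes X :: "complex ^ 'c ^ 'a" and Y :: "complex ^ 'b ^ 'a" and Z :: "complex ^ 'c ^ 'b"
  shows "X \<bullet> (Y ** Z) = (ctrans Y ** X) \<bullet> Z"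
proof -
  have "(\<Sum>i\<in>UNIV. \<Sum>j\<in>UNIV. cnj (X$i$j) * (Y ** Z)$i$j) =
     (\<Sum>i\<in>UNIV. \<Sum>j\<in>UNIV. \<Sum>k\<in>UNIV. cnj (X$i$j) * Y$i$k * Z$k$j)"
    by (simp add: matrix_matrix_mult_def sum_distrib_left mult.assoc)
  also have "\<dots> = (\<Sum>i\<in>UNIV. \<Sum>k\<in>UNIV. \<Sum>j\<in>UNIV. cnj (X$i$j) * Y$i$k * Z$k$j)"
    by (intro sum.cong refl sum.swap)
  also have "\<dots> = (\<Sum>k\<in>UNIV. \<Sum>i\<in>UNIV. \<Sum>j\<in>UNIV. cnj (X$i$j) * Y$i$k * Z$k$j)"
    by (rule sum.swap)
  also have "\<dots> = (\<Sum>k\<in>UNIV. \<Sum>j\<in>UNIV. \<Sum>i\<in>UNIV. cnj (X$i$j) * Y$i$k * Z$k$j)"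
    by (intro sum.cong refl sum.swap)
  also have "\<dots> = (\<Sum>k\<in>UNIV. \<Sum>j\<in>UNIV. cnj ((ctrans Y ** X)$k$j) * Z$k$j)"
    by (simp add: matrix_matrix_mult_def sum_distrib_right sum_distrib_left mult_ac)
  finally show ?thesis unfolding inner_mat_eq by simp
qed

lemma inner_ctrans: "ctrans X \<bullet> ctrans Y = X \<bullet> Y"
  unfolding inner_mat_eq by (subst sum.swap) (simp add: mult.commute)

lemma inner_mult_adjoint_right:
  fixes X :: "complex ^ 'c ^ 'a" and Y :: "complex ^ 'b ^ 'a" and Z :: "complex ^ 'c ^ 'b"
  shows "X \<bullet> (Y ** Z) = (X ** ctrans Z) \<bullet> Y"
  using inner_mult_adjoint_left[of "ctrans X" "ctrans Z" "ctrans Y"]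
  by (metis ctrans_ctrans ctrans_mult inner_ctrans)

text \<open>Taking adjoints is an isometry that fixes Hermitian and negates skew matrices.\<close>

lemma inner_hermitian_skew: "ctrans X = X \<Longrightarrow> ctrans Y = - Y \<Longrightarrow> X \<bullet> Y = 0"
  using inner_ctrans[of X Y] by simp

section \<open>Unitary matrices\<close>

lemma norm_unitary_mult: "unitary U \<Longrightarrow> norm (U ** X) = norm X"
  unfolding norm_eq_sqrt_inner unitary_def
  by (simp add: inner_mult_adjoint_left matrix_mul_assoc)

lemma norm_mult_unitary:
  assumes "unitary U" shows "norm (X ** U) = norm X"
proof -
  have "norm (X ** U) = norm (ctrans U ** ctrans X)" by (metis norm_ctrans ctrans_mult)
  also have "\<dots> = norm X"
    using assms norm_unitary_mult[of "ctrans U" "ctrans X"] by (simp add: unitary_def)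
  finally show ?thesis .
qed

lemma unitary_ctrans: "unitary U \<Longrightarrow> unitary (ctrans U)"
  by (simp add: unitary_def)

lemma unitary_mult:
  assumes "unitary U" "unitary V" shows "unitary (U ** V)"
  using assms unfolding unitary_def ctrans_mult
  by (metis matrix_mul_assoc matrix_mul_rid)

lemma norm_unitary: "unitary U \<Longrightarrow> norm U = norm (mat 1 :: complex ^ 'n ^ 'n)"
  for U :: "complex ^ 'n ^ 'n"
  using norm_unitary_mult[of U "mat 1"] by simp

lemma unitary_cancel:
  assumes "unitary U"
  shows "U ** ctrans U = mat 1" "ctrans U ** U = mat 1"
    "U ** (ctrans U ** X) = X" "ctrans U ** (U ** X) = X"
  using assms by (simp_all add: unitary_def matrix_mul_assoc)

lemma matrix_inv_unitary:
  assumes "unitary U" shows "matrix_inv U = ctrans U"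
proof -
  have "U ** matrix_inv U = mat 1 \<and> matrix_inv U ** U = mat 1"
    unfolding matrix_inv_def by (rule someI[of _ "ctrans U"]) (use assms in \<open>simp add: unitary_def\<close>)
  then show ?thesis
    using assms unfolding unitary_def by (metis matrix_mul_assoc matrix_mul_lid matrix_mul_rid)
qed

lemma unitaryI: "ctrans U ** U = mat 1 \<Longrightarrow> unitary U"
  by (simp add: unitary_def matrix_left_right_inverse)

section \<open>Block matrices, the base point and the space \<open>u_perp\<close>\<close>

lemma sum_UNIV_Plus:
  "(\<Sum>x\<in>(UNIV :: ('k::finite + 'm::finite) set). f x) = (\<Sum>r\<in>UNIV. f (Inl r)) + (\<Sum>s\<in>UNIV. f (Inr s))"
  unfolding UNIV_Plus_UNIV[symmetric] by (subst sum.Plus) auto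

lemma blk_nth [simp]:
  "blk A B C D $ Inl r $ Inl s = A $ r $ s" "blk A B C D $ Inl r $ Inr s' = B $ r $ s'"
  "blk A B C D $ Inr r' $ Inl s = C $ r' $ s" "blk A B C D $ Inr r' $ Inr s' = D $ r' $ s'"
  by (simp_all add: blk_def)

lemma vec_sum_eq_iff:
  fixes X Y :: "('k::finite, 'm::finite) mat"
  shows "X = Y \<longleftrightarrow> (\<forall>r s. X$Inl r$Inl s = Y$Inl r$Inl s) \<and> (\<forall>r s. X$Inl r$Inr s = Y$Inl r$Inr s)
    \<and> (\<forall>r s. X$Inr r$Inl s = Y$Inr r$Inl s) \<and> (\<forall>r s. X$Inr r$Inr s = Y$Inr r$Inr s)"
  by (simp add: vec_eq_iff split_sum_all) blast

lemma a_pt_mult_nth: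
  fixes X :: "('k::finite, 'm::finite) mat"
  shows "(a_pt ** X) $ Inl r $ j = \<i>/2 * X $ Inl r $ j" "(a_pt ** X) $ Inr s $ j = - \<i>/2 * X $ Inr s $ j"
    "(X ** a_pt) $ i $ Inl r = \<i>/2 * X $ i $ Inl r" "(X ** a_pt) $ i $ Inr s = - \<i>/2 * X $ i $ Inr s"
  by (simp_all add: matrix_matrix_mult_def sum_UNIV_Plus a_pt_def cscale_def mat_def
      if_distrib[of "\<lambda>x. x * _"] if_distrib[of "\<lambda>x. _ * x"] sum.delta sum.delta' cong: if_cong)

lemma a_pt_square: "a_pt ** a_pt = - (1/4) *\<^sub>R (mat 1 :: ('k::finite, 'm::finite) mat)"
  unfolding vec_sum_eq_iff by (simp add: a_pt_mult_nth)
    (simp add: a_pt_def cscale_def mat_def scaleR_conv_of_real)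

lemma ctrans_a_pt [simp]: "ctrans a_pt = - a_pt"
  by (simp add: vec_sum_eq_iff) (auto simp: a_pt_def cscale_def mat_def)

text \<open>A coordinate-free description: anticommuting with \<open>a_pt\<close> kills the diagonal
  blocks, and skewness ties the other two together. Membership can then be checked under conjugation
  without looking at entries.\<close>

lemma u_perp_iff:
  fixes X :: "('k::finite, 'm::finite) mat"
  shows "X \<in> u_perp \<longleftrightarrow> ctrans X = - X \<and> X ** a_pt = - (a_pt ** X)"
proof
  assume "X \<in> u_perp"
  then show "ctrans X = - X \<and> X ** a_pt = - (a_pt ** X)"
    by (auto simp: u_perp_def vec_sum_eq_iff a_pt_mult_nth)
next
  assume *: "ctrans X = - X \<and> X ** a_pt = - (a_pt ** X)"
  then have a: "X ** a_pt = - (a_pt ** X)" and c: "ctrans X = - X" by auto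
  have "X $ Inl r $ Inl s = 0" for r s
    using arg_cong[OF a, of "\<lambda>Y. Y $ Inl r $ Inl s"] by (simp add: a_pt_mult_nth)
  moreover have "X $ Inr r $ Inr s = 0" for r s
    using arg_cong[OF a, of "\<lambda>Y. Y $ Inr r $ Inr s"] by (simp add: a_pt_mult_nth)
  moreover have "X $ Inr r $ Inl s = - cnj (X $ Inl s $ Inr r)" for r s
    using arg_cong[OF c, of "\<lambda>Y. Y $ Inr r $ Inl s"] by simp
  ultimately have "X = blk 0 (ublk X) (- ctrans (ublk X)) 0"
    by (simp add: vec_sum_eq_iff ublk_def)
  then show "X \<in> u_perp" unfolding u_perp_def by blast
qed

text \<open>Left multiplication by \<open>a_pt\<close> scales the upper rows by i/2 and the lower
  rows by -i/2; the term with \<open>v\<close> gives the off-diagonal blocks of \<open>Q2\<close>,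
  the term with \<open>u ** u\<close> the diagonal ones.\<close>

lemma Q2_eq:
  fixes u v :: "('k::finite, 'm::finite) mat"
  assumes "u \<in> u_perp" "v \<in> u_perp"
  shows "Q2 u v = 2 *\<^sub>R (a_pt ** v) + 2 *\<^sub>R (a_pt ** (u ** u))"
proof -
  obtain q p where "u = blk 0 q (- ctrans q) 0" "v = blk 0 p (- ctrans p) 0"
    using assms by (auto simp: u_perp_def)
  then show ?thesis
    unfolding vec_sum_eq_iff
    by (simp add: Q2_def Let_def a_pt_mult_nth ublk_def ctrans_def cscale_def
       scaleR_conv_of_real)
      (simp add: matrix_matrix_mult_def sum_UNIV_Plus sum_negf)
qed

section \<open>Smooth functions and linear differential equations\<close>

text \<open>A finite-order version of smoothness: closure under products and the bootstrap for
  differential equations go by induction on the order.\<close>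

definition ndiff :: "nat \<Rightarrow> (real \<Rightarrow> 'a::real_normed_vector) \<Rightarrow> bool" where
  "ndiff n f \<longleftrightarrow> (\<forall>m<n. \<forall>x. (vderivs m f has_vector_derivative vderivs (Suc m) f x) (at x))"

lemma smooth_fun_iff_ndiff: "smooth_fun f \<longleftrightarrow> (\<forall>n. ndiff n f)"
  unfolding smooth_fun_def ndiff_def by blast

text \<open>\<open>vderivs\<close> adds derivatives on the outside, while the inductions on the
  order strip one from the inside.\<close>

lemma vderivs_Suc_shift: "vderivs (Suc m) f = vderivs m (vderivs 1 f)"
  by (induction m) auto

lemma vderivs_1I:
  assumes "\<And>x. (f has_vector_derivative f' x) (at x)" shows "vderivs 1 f = f'"
  using vector_derivative_at[OF assms] by auto

lemma ndiff_SucI: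
  assumes "\<And>x. (f has_vector_derivative f' x) (at x)" "ndiff n f'"
  shows "ndiff (Suc n) f"
  unfolding ndiff_def
proof (intro allI impI)
  fix m x assume "m < Suc n"
  show "(vderivs m f has_vector_derivative vderivs (Suc m) f x) (at x)"
  proof (cases m)
    case 0
    then show ?thesis using assms(1) vderivs_1I[OF assms(1)] by simp
  next
    case (Suc l)
    then show ?thesis
      using assms(2) \<open>m < Suc n\<close> unfolding Suc vderivs_Suc_shift vderivs_1I[OF assms(1)] ndiff_def by simp
  qed
qed

lemma ndiff_SucD:
  assumes "ndiff (Suc n) f"
  shows "(f has_vector_derivative vderivs 1 f x) (at x)" "ndiff n (vderivs 1 f)"
proof -
  show "(f has_vector_derivative vderivs 1 f x) (at x)"
    using assms[unfolded ndiff_def, rule_format, of 0 x] by simp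
  show "ndiff n (vderivs 1 f)"
    unfolding ndiff_def vderivs_Suc_shift[symmetric]
    using assms[unfolded ndiff_def] by (simp del: vderivs.simps)
qed

lemma ndiff_Suc_lower: "ndiff (Suc n) f \<Longrightarrow> ndiff n f"
  by (simp add: ndiff_def)

lemma ndiff_add: "ndiff n f \<Longrightarrow> ndiff n g \<Longrightarrow> ndiff n (\<lambda>x. f x + g x)"
proof (induction n arbitrary: f g)
  case (Suc n)
  show ?case
    by (rule ndiff_SucI[OF _ Suc.IH[OF Suc.prems[THEN ndiff_SucD(2)]]])
      (intro derivative_intros Suc.prems[THEN ndiff_SucD(1)])
qed (simp add: ndiff_def)

lemma ndiff_scaleR: "ndiff n f \<Longrightarrow> ndiff n (\<lambda>x. (r::real) *\<^sub>R f x)"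
proof (induction n arbitrary: f)
  case (Suc n)
  show ?case
    by (rule ndiff_SucI[OF _ Suc.IH[OF Suc.prems[THEN ndiff_SucD(2)]]])
      (use Suc.prems[THEN ndiff_SucD(1)] in \<open>auto intro!: derivative_eq_intros\<close>)
qed (simp add: ndiff_def)

lemma ndiff_mat_mult:
  fixes f :: "real \<Rightarrow> complex ^ 'b ^ 'a" and g :: "real \<Rightarrow> complex ^ 'c ^ 'b"
  shows "ndiff n f \<Longrightarrow> ndiff n g \<Longrightarrow> ndiff n (\<lambda>x. f x ** g x)"
proof (induction n arbitrary: f g)
  case (Suc n)
  show ?case
  proof (rule ndiff_SucI)
    show "((\<lambda>x. f x ** g x) has_vector_derivative (f x ** vderivs 1 g x + vderivs 1 f x ** g x)) (at x)" for x
      by (intro has_vector_derivative_mat_mult Suc.prems[THEN ndiff_SucD(1)])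
    show "ndiff n (\<lambda>x. f x ** vderivs 1 g x + vderivs 1 f x ** g x)"
      by (intro ndiff_add Suc.IH Suc.prems[THEN ndiff_SucD(2)] Suc.prems[THEN ndiff_Suc_lower])
  qed
qed (simp add: ndiff_def)

text \<open>If \<open>g\<close> has n derivatives, then so has its derivative
  \<open>A x ** g x\<close>; hence \<open>g\<close> has n + 1.\<close>

lemma smooth_fun_linear_ode:
  fixes g :: "real \<Rightarrow> complex ^ 'b ^ 'a" and A :: "real \<Rightarrow> complex ^ 'a ^ 'a"
  assumes "smooth_fun A" "\<And>x. (g has_vector_derivative A x ** g x) (at x)"
  shows "smooth_fun g"
proof -
  have "ndiff n g" for n
  proof (induction n)
    case (Suc n)
    then show ?case
      using assms by (intro ndiff_SucI[where f' = "\<lambda>x. A x ** g x"] ndiff_mat_mult) (auto simp: smooth_fun_iff_ndiff)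
  qed (simp add: ndiff_def)
  then show ?thesis by (simp add: smooth_fun_iff_ndiff)
qed

lemma smooth_fun_mat_mult:
  "smooth_fun f \<Longrightarrow> smooth_fun g \<Longrightarrow> smooth_fun (\<lambda>x. f x ** (g x :: complex ^ 'c ^ 'b))"
  by (simp add: smooth_fun_iff_ndiff ndiff_mat_mult)

lemma smooth_fun_scaleR: "smooth_fun f \<Longrightarrow> smooth_fun (\<lambda>x. (r::real) *\<^sub>R f x)"
  by (simp add: smooth_fun_iff_ndiff ndiff_scaleR)

lemma smooth_fun_vderivs_1: "smooth_fun f \<Longrightarrow> smooth_fun (vderivs 1 f)"
  using ndiff_SucD(2) by (auto simp: smooth_fun_iff_ndiff)

text \<open>A contraction in an exponentially weighted supremum norm (Bielecki) solves the equation
  on the whole interval at once, without gluing short pieces.\<close>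

lemma linear_ode_exists_interval:
  fixes A :: "real \<Rightarrow> complex ^ 'n ^ 'n" and h0 :: "complex ^ 'm ^ 'n"
  assumes "continuous_on UNIV A" "a \<le> b"
  shows "\<exists>h. h a = h0 \<and> continuous_on {a..b} h \<and>
     (\<forall>y\<in>{a<..<b}. (h has_vector_derivative A y ** h y) (at y))"
proof -
  have "compact (A ` {a..b})"
    using assms(1) by (intro compact_continuous_image continuous_on_subset[OF assms(1)]) auto
  then obtain K where K: "K > 0" "\<And>y. y \<in> {a..b} \<Longrightarrow> norm (A y) \<le> K"
    using compact_imp_bounded bounded_pos by (metis (no_types, lifting) image_eqI)
  \<comment> \<open>Clamping to [a, b] turns functions on the interval into bounded continuous
    functions on the line, the complete space in which the fixed point is found.\<close>
  let ?c = "\<lambda>y. max a (min b y)"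
  have c: "?c y \<in> {a..b}" for y using assms(2) by auto
  have contc: "continuous_on UNIV ?c" by (intro continuous_intros)
  \<comment> \<open>The fixed point is the solution divided by this weight. With exponent 2 K the
    integral of \<open>K * E\<close> stays below \<open>E / 2\<close>, whence the contraction factor
    1/2.\<close>
  define E where "E z = exp (2 * K * (z - a))" for z :: real
  have E0: "E z > 0" for z by (simp add: E_def)
  have contE: "continuous_on S E" for S unfolding E_def by (intro continuous_intros)
  define J where "J v y = h0 + integral {a..y} (\<lambda>z. E z *\<^sub>R (A z ** v z))" for v :: "real \<Rightarrow> complex ^ 'm ^ 'n" and y
  define T where "T v y = inverse (E (?c y)) *\<^sub>R J v (?c y)" for v y
  have contA: "continuous_on S A" for S using assms(1) continuous_on_subset by blast
  have contI: "continuous_on {a..b} (\<lambda>z. E z *\<^sub>R (A z ** v z))" if "continuous_on UNIV v" for v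
    by (intro continuous_intros contE mat_mult.continuous_on contA continuous_on_subset[OF that]) auto
  have contJ: "continuous_on {a..b} (J v)" if "continuous_on UNIV v" for v
    unfolding J_def
    by (intro continuous_intros indefinite_integral_continuous_1 integrable_continuous_interval contI that)
  have contT: "continuous_on UNIV (T v)" if "continuous_on UNIV v" for v
  proof -
    have "continuous_on {a..b} (\<lambda>y. inverse (E y) *\<^sub>R J v y)"
      using E0 by (intro continuous_intros contE contJ that) (metis less_irrefl)
    then show ?thesis
      unfolding T_def by (rule continuous_on_compose2[OF _ contc]) (use c in blast)
  qed
  have bndT: "bounded (range (T v))" if "continuous_on UNIV v" for v
  proof -
    have "range (T v) = T v ` {a..b}"
    proof -
      have "T v y = T v (?c y)" for y unfolding T_def using assms(2) by (simp add: max_def min_def)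
      then show ?thesis using c by (metis (no_types, lifting) image_iff UNIV_I subsetI subset_antisym)
    qed
    then show ?thesis
      using contT[OF that] by (metis compact_continuous_image compact_imp_bounded compact_Icc continuous_on_subset top_greatest)
  qed
  have inT: "T v \<in> bcontfun" if "continuous_on UNIV v" for v
    using contT[OF that] bndT[OF that] by (simp add: bcontfun_def)
  define F where "F v = Bcontfun (T (apply_bcontfun v))" for v
  have appF: "apply_bcontfun (F v) = T (apply_bcontfun v)" for v
    unfolding F_def by (rule Bcontfun_inverse) (rule inT, rule continuous_on_apply_bcontfun)
  have intE: "((\<lambda>z. K * E z) has_integral (E y - 1) / 2) {a..y}" if "a \<le> y" for y
  proof -
    have "((\<lambda>z. K * E z) has_integral E y / 2 - E a / 2) {a..y}"
      unfolding E_def using that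
      by (intro fundamental_theorem_of_calculus)
        (auto intro!: derivative_eq_intros simp: has_real_derivative_iff_has_vector_derivative[symmetric])
    then show ?thesis by (simp add: E_def diff_divide_distrib)
  qed
  have "dist (F v) (F w) \<le> 1/2 * dist v w" for v w
  proof (rule dist_bound)
    fix y
    let ?y = "?c y"
    have y: "?y \<in> {a..b}" by (rule c)
    have cv: "continuous_on UNIV (apply_bcontfun v)" "continuous_on UNIV (apply_bcontfun w)" by auto
    have i: "(\<lambda>z. E z *\<^sub>R (A z ** apply_bcontfun u z)) integrable_on {a..?y}" for u
      using y by (intro integrable_continuous_interval continuous_on_subset[OF contI]) auto
    have "norm (J v ?y - J w ?y) = norm (integral {a..?y} (\<lambda>z. E z *\<^sub>R (A z ** (v z - w z))))"
      unfolding J_def by (simp add: integral_diff[OF i i] scaleR_diff_right mat_mult.diff_right)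
    also have "\<dots> \<le> integral {a..?y} (\<lambda>z. K * E z * dist v w)"
    proof (rule integral_norm_bound_integral)
      show "(\<lambda>z. E z *\<^sub>R (A z ** (v z - w z))) integrable_on {a..?y}"
        using integrable_diff[OF i[of v] i[of w]] by (simp add: scaleR_diff_right mat_mult.diff_right)
      show "(\<lambda>z. K * E z * dist v w) integrable_on {a..?y}"
        by (intro integrable_continuous_interval continuous_intros contE)
      fix z assume z: "z \<in> {a..?y}"
      have "norm (A z ** (v z - w z)) \<le> norm (A z) * norm (v z - w z)" by (rule norm_mat_mult_le)
      also have "\<dots> \<le> K * dist v w"
        using K(2)[of z] z y K(1) dist_bounded[of v z w] by (intro mult_mono) (auto simp: dist_norm)
      finally show "norm (E z *\<^sub>R (A z ** (v z - w z))) \<le> K * E z * dist v w"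
        using E0[of z] by (simp add: mult.commute mult.left_commute)
    qed
    also have "\<dots> = (E ?y - 1) / 2 * dist v w"
      using intE[of ?y] y by (intro integral_unique has_integral_mult_left) auto
    also have "\<dots> \<le> E ?y / 2 * dist v w" by (intro mult_right_mono) auto
    finally have "norm (J v ?y - J w ?y) \<le> E ?y / 2 * dist v w" .
    then have "inverse (E ?y) * norm (J v ?y - J w ?y) \<le> inverse (E ?y) * (E ?y / 2 * dist v w)"
      using E0[of ?y] by (intro mult_left_mono) auto
    also have "\<dots> = 1/2 * dist v w" using E0[of ?y] by simp
    finally show "dist (apply_bcontfun (F v) y) (apply_bcontfun (F w) y) \<le> 1/2 * dist v w"
      unfolding appF T_def dist_norm scaleR_diff_right[symmetric] using E0[of ?y] by simp
  qed
  then obtain v where v: "F v = v"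
    using banach_fix_type[of "1/2" F] by auto
  define h where "h y = J (apply_bcontfun v) y" for y
  have hv: "E y *\<^sub>R v y = h y" if "y \<in> {a..b}" for y
  proof -
    have "v y = T v y" using v appF by metis
    moreover have "?c y = y" using that by auto
    ultimately show ?thesis using E0[of y] by (simp add: T_def h_def)
  qed
  have cv: "continuous_on UNIV (apply_bcontfun v)" by auto
  have "(h has_vector_derivative A y ** h y) (at y)" if "y \<in> {a<..<b}" for y
  proof -
    have "((\<lambda>y. integral {a..y} (\<lambda>z. E z *\<^sub>R (A z ** v z))) has_vector_derivative E y *\<^sub>R (A y ** v y)) (at y within {a..b})"
      using that by (intro integral_has_vector_derivative contI cv) auto
    then have "((\<lambda>y. integral {a..y} (\<lambda>z. E z *\<^sub>R (A z ** v z))) has_vector_derivative E y *\<^sub>R (A y ** v y)) (at y)"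
      using that by (simp add: at_within_Icc_at)
    then have "(h has_vector_derivative 0 + E y *\<^sub>R (A y ** v y)) (at y)"
      unfolding h_def[abs_def] J_def by (intro has_vector_derivative_add has_vector_derivative_const)
    moreover have "E y *\<^sub>R (A y ** v y) = A y ** h y"
      using hv[of y] that by (simp add: mat_mult.scaleR_right[symmetric])
    ultimately show ?thesis by simp
  qed
  moreover have "h a = h0" by (simp add: h_def J_def)
  moreover have "continuous_on {a..b} h" unfolding h_def[abs_def] by (rule contJ) auto
  ultimately show ?thesis by blast
qed

text \<open>The substitution \<open>x = tan y\<close> compactifies the line; the decay of the coefficient makes the
  transformed equation regular up to the end points.\<close>

lemma linear_ode_exists_at_bot:
  fixes A :: "real \<Rightarrow> complex ^ 'n ^ 'n" and g0 :: "complex ^ 'm ^ 'n"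
  assumes cont: "continuous_on UNIV A" and bound: "\<And>x. norm (A x) * (1 + x\<^sup>2)\<^sup>2 \<le> C"
  shows "\<exists>g. (\<forall>x. (g has_vector_derivative A x ** g x) (at x)) \<and> (g \<longlongrightarrow> g0) at_bot"
proof -
  \<comment> \<open>The coefficient after the substitution, with the Jacobian of tan; the value 0
    elsewhere is its continuous extension.\<close>
  define D where "D y = (if \<bar>y\<bar> < pi/2 then (1 + (tan y)\<^sup>2) *\<^sub>R A (tan y) else 0)" for y
  have cospos: "cos y > 0" if "\<bar>y\<bar> < pi/2" for y using that by (intro cos_gt_zero_pi) auto
  have C0: "C \<ge> 0" by (rule order.trans[OF _ bound[of 0]]) simp
  \<comment> \<open>One of the two factors \<open>1 + x^2\<close> in the weight pays for the
    Jacobian, the other becomes the square of cos and forces \<open>D\<close> to vanish at the end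
    points.\<close>
  have Dbound: "norm (D y) \<le> C * (cos y)\<^sup>2" for y
  proof (cases "\<bar>y\<bar> < pi/2")
    case True
    have "1 + (tan y)\<^sup>2 = inverse ((cos y)\<^sup>2)"
      using tan_sec[of y] cospos[OF True] by (simp add: power_inverse)
    moreover have "norm (D y) * (1 + (tan y)\<^sup>2) \<le> C"
      using True bound[of "tan y"] by (simp add: D_def power2_eq_square mult_ac)
    ultimately have "norm (D y) * inverse ((cos y)\<^sup>2) \<le> C" by simp
    then show ?thesis using cospos[OF True] by (simp add: field_simps)
  next
    case False then show ?thesis using C0 by (simp add: D_def)
  qed
  have "isCont D y" for y
  proof -
    consider "\<bar>y\<bar> < pi/2" | "\<bar>y\<bar> > pi/2" | "\<bar>y\<bar> = pi/2" by linarith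
    then show ?thesis
    proof cases
      case 1
      have "isCont (\<lambda>y. (1 + (tan y)\<^sup>2) *\<^sub>R A (tan y)) y"
        using cospos[OF 1] cont
        by (intro continuous_intros isCont_o2[of y tan A]) (auto simp: continuous_on_eq_continuous_at)
      moreover have "\<forall>\<^sub>F z in nhds y. D z = (1 + (tan z)\<^sup>2) *\<^sub>R A (tan z)"
      proof (rule eventually_mono)
        show "\<forall>\<^sub>F z in nhds y. z \<in> {-pi/2<..<pi/2}" using 1 by (intro eventually_nhds_in_open) auto
      qed (auto simp: D_def)
      ultimately show ?thesis by (simp add: isCont_cong)
    next
      case 2
      have "\<forall>\<^sub>F z in nhds y. D z = 0"
      proof (rule eventually_mono)
        show "\<forall>\<^sub>F z in nhds y. z \<in> - {-pi/2..pi/2}" using 2 by (intro eventually_nhds_in_open) (auto simp: open_Compl)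
      qed (auto simp: D_def)
      then show ?thesis by (simp add: isCont_cong)
    next
      case 3
      have "cos y = 0" using 3 by (metis abs_if cos_minus cos_pi_half minus_minus)
      then have "((\<lambda>z. C * (cos z)\<^sup>2) \<longlongrightarrow> 0) (at y)"
        by (auto intro!: tendsto_eq_intros)
      then have "(D \<longlongrightarrow> 0) (at y)"
        by (rule Lim_null_comparison[rotated]) (simp add: Dbound)
      then show ?thesis using 3 by (simp add: isCont_def D_def)
    qed
  qed
  then have "continuous_on UNIV D" by (simp add: continuous_at_imp_continuous_on)
  from linear_ode_exists_interval[OF this, of "-pi/2" "pi/2" g0]
  obtain h where h: "h (-pi/2) = g0" "continuous_on {-pi/2..pi/2} h"
    "\<And>y. y \<in> {-pi/2<..<pi/2} \<Longrightarrow> (h has_vector_derivative D y ** h y) (at y)"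
    by auto
  have "((\<lambda>x. h (arctan x)) has_vector_derivative A x ** h (arctan x)) (at x)" for x
  proof -
    have ar: "arctan x \<in> {-pi/2<..<pi/2}" using arctan_bounded[of x] by auto
    have "(arctan has_vector_derivative inverse (1 + x\<^sup>2)) (at x)"
      using DERIV_arctan[of x] has_real_derivative_iff_has_vector_derivative by blast
    from vector_diff_chain_at[OF this h(3)[OF ar]]
    have "((\<lambda>x. h (arctan x)) has_vector_derivative inverse (1 + x\<^sup>2) *\<^sub>R (D (arctan x) ** h (arctan x))) (at x)"
      by (simp add: o_def)
    moreover have "inverse (1 + x\<^sup>2) *\<^sub>R D (arctan x) = A x"
    proof -
      have "\<bar>arctan x\<bar> < pi/2" using ar by auto
      moreover have "1 + x\<^sup>2 \<noteq> 0" by (metis add_pos_nonneg less_irrefl zero_le_power2 zero_less_one)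
      ultimately show ?thesis by (simp add: D_def tan_arctan)
    qed
    ultimately show ?thesis by (simp add: mat_mult.scaleR_left[symmetric])
  qed
  moreover have "((\<lambda>x. h (arctan x)) \<longlongrightarrow> g0) at_bot"
  proof -
    have "(h \<longlongrightarrow> h (-pi/2)) (at (-pi/2) within {-pi/2..pi/2})"
      using h(2) by (simp add: continuous_on)
    moreover have "filterlim arctan (at (-pi/2) within {-pi/2..pi/2}) at_bot"
      unfolding filterlim_at
      using tendsto_arctan_at_bot arctan_bounded by (auto intro!: always_eventually simp: less_imp_le) (metis less_irrefl)+
    ultimately show ?thesis using h(1) by (metis filterlim_compose)
  qed
  ultimately show ?thesis by blast
qed

section \<open>The development map\<close>

lemma mat_mult_assoc_subst: "X ** Y = Z \<Longrightarrow> X ** (Y ** W) = Z ** W"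
  for X Y Z :: "complex ^ 'n ^ 'n" and W :: "complex ^ 'm ^ 'n"
  by (simp add: matrix_mul_assoc)

section \<open>Algebra of the orbit\<close>

lemma orbitM_skew: "X \<in> orbitM \<Longrightarrow> ctrans X = - X"
  by (auto simp: orbitM_def ctrans_mult mat_algebra)

lemma orbitM_square:
  assumes "X \<in> orbitM" shows "X ** X = - (1/4) *\<^sub>R mat 1"
proof -
  obtain g where g: "X = g ** a_pt ** ctrans g" "unitary g" using assms by (auto simp: orbitM_def)
  show ?thesis
    unfolding g(1)
    by (simp add: mat_algebra unitary_cancel[OF g(2)] mat_mult_assoc_subst[OF a_pt_square])
qed

text \<open>Twice a point of the orbit is skew with square -1, hence unitary.\<close>

lemma norm_orbitM_mult:
  assumes "X \<in> orbitM" shows "norm (2 *\<^sub>R (X ** Y)) = norm Y"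
proof -
  have "(2 *\<^sub>R (X ** Y)) \<bullet> (2 *\<^sub>R (X ** Y)) = Y \<bullet> Y"
    by (simp add: inner_mult_adjoint_left mat_algebra orbitM_skew[OF assms] mat_mult_assoc_subst[OF orbitM_square[OF assms]])
  then show ?thesis by (simp add: norm_eq_sqrt_inner)
qed

lemma norm_orbitM_mult': "X \<in> orbitM \<Longrightarrow> norm (X ** Y) = norm Y / 2"
  using norm_orbitM_mult[of X Y] by simp

lemma smooth_fun_has_vector_derivative:
  "smooth_fun f \<Longrightarrow> (vderivs m f has_vector_derivative vderivs (Suc m) f x) (at x)"
  by (simp add: smooth_fun_def)

lemma smooth_fun_continuous: "smooth_fun f \<Longrightarrow> continuous_on S f"
  using smooth_fun_has_vector_derivative[of f 0]
  by (intro continuous_at_imp_continuous_on) (auto intro: has_vector_derivative_continuous)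

lemma constant_of_tendsto_at_bot:
  fixes f :: "real \<Rightarrow> 'a::real_normed_vector"
  assumes "\<And>x. (f has_vector_derivative 0) (at x)" "(f \<longlongrightarrow> c) at_bot"
  shows "f x = c"
proof -
  obtain d where d: "\<And>x. f x = d"
    using has_vector_derivative_zero_constant[of UNIV f] assms(1) by auto
  then have "f = (\<lambda>_. d)" by auto
  then show ?thesis using tendsto_unique[OF _ _ assms(2), of d] by auto
qed

text \<open>For \<open>\<gamma>\<close> in \<open>C_a\<close> this is the only matrix that
  anticommutes with \<open>\<gamma> x\<close> and whose commutator with \<open>\<gamma> x\<close> is
  the velocity of \<open>\<gamma>\<close>. These two properties force it on every frame.\<close>

definition connection :: "(real \<Rightarrow> ('k::finite,'m::finite) mat) \<Rightarrow> real \<Rightarrow> ('k,'m) mat" where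
  "connection \<gamma> x = 2 *\<^sub>R (\<gamma> x ** vderivs 1 \<gamma> x)"

context
  fixes \<gamma> :: "real \<Rightarrow> ('k::finite,'m::finite) mat"
  assumes \<gamma>: "\<gamma> \<in> C_a"
begin

lemma
  shows smooth_C_a: "smooth_fun \<gamma>" and orbitM_C_a: "\<gamma> x \<in> orbitM"
    and tendsto_C_a: "(\<gamma> \<longlongrightarrow> a_pt) at_bot" and schwartz_C_a: "schwartz (vderivs 1 \<gamma>)"
  using \<gamma> by (simp_all add: C_a_def)

lemma C_a_deriv: "(\<gamma> has_vector_derivative vderivs 1 \<gamma> x) (at x)"
  using smooth_fun_has_vector_derivative[OF smooth_C_a, of 0 x] by simp

lemma C_a_deriv_skew: "ctrans (vderivs 1 \<gamma> x) = - vderivs 1 \<gamma> x"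
proof -
  have "((\<lambda>x. ctrans (\<gamma> x)) has_vector_derivative ctrans (vderivs 1 \<gamma> x)) (at x)"
    by (intro has_vector_derivative_ctrans C_a_deriv)
  moreover have "((\<lambda>x. ctrans (\<gamma> x)) has_vector_derivative - vderivs 1 \<gamma> x) (at x)"
    unfolding orbitM_skew[OF orbitM_C_a] by (intro has_vector_derivative_minus C_a_deriv)
  ultimately show ?thesis by (rule vector_derivative_unique_at)
qed

lemma C_a_deriv_anticommute: "vderivs 1 \<gamma> x ** \<gamma> x = - (\<gamma> x ** vderivs 1 \<gamma> x)"
proof -
  have "((\<lambda>x. \<gamma> x ** \<gamma> x) has_vector_derivative \<gamma> x ** vderivs 1 \<gamma> x + vderivs 1 \<gamma> x ** \<gamma> x) (at x)"
    by (intro has_vector_derivative_mat_mult C_a_deriv)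
  moreover have "((\<lambda>x. \<gamma> x ** \<gamma> x) has_vector_derivative 0) (at x)"
    unfolding orbitM_square[OF orbitM_C_a] by (rule has_vector_derivative_const)
  ultimately have "\<gamma> x ** vderivs 1 \<gamma> x + vderivs 1 \<gamma> x ** \<gamma> x = 0" by (rule vector_derivative_unique_at)
  then show ?thesis by (simp add: add_eq_0_iff)
qed

lemmas C_a_rewrites =
  orbitM_square[OF orbitM_C_a] orbitM_square[OF orbitM_C_a, THEN mat_mult_assoc_subst]
  C_a_deriv_anticommute C_a_deriv_anticommute[THEN mat_mult_assoc_subst]

lemma connection_skew: "ctrans (connection \<gamma> x) = - connection \<gamma> x"
  by (simp add: connection_def ctrans_scaleR ctrans_mult C_a_deriv_skew orbitM_skew[OF orbitM_C_a]
     C_a_deriv_anticommute mat_algebra del: vderivs.simps One_nat_def)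

lemma connection_commutator: "connection \<gamma> x ** \<gamma> x - \<gamma> x ** connection \<gamma> x = vderivs 1 \<gamma> x"
  by (simp add: connection_def mat_algebra C_a_rewrites del: vderivs.simps One_nat_def)

lemma connection_anticommute: "connection \<gamma> x ** \<gamma> x = - (\<gamma> x ** connection \<gamma> x)"
  by (simp add: connection_def mat_algebra C_a_rewrites del: vderivs.simps One_nat_def)

lemma smooth_connection: "smooth_fun (connection \<gamma>)"
  unfolding connection_def[abs_def]
  by (intro smooth_fun_scaleR smooth_fun_mat_mult smooth_fun_vderivs_1 smooth_C_a)

text \<open>The weight is the one demanded by \<open>linear_ode_exists_at_bot\<close>. Since
  multiplication by \<open>2 \<gamma>\<close> is isometric, only the derivative of
  \<open>\<gamma>\<close> counts, and expanding the weight leaves its moments of order 0, 2 and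
  4.\<close>

lemma connection_decay: "\<exists>C. \<forall>x. norm (connection \<gamma> x) * (1 + x\<^sup>2)\<^sup>2 \<le> C"
proof -
  have "\<exists>C. \<forall>x. \<bar>x\<bar> ^ j * norm (vderivs 1 \<gamma> x) \<le> C" for j
    using schwartz_C_a unfolding schwartz_def by (metis vderivs.simps(1))
  then obtain C where C: "\<And>j x. \<bar>x\<bar> ^ j * norm (vderivs 1 \<gamma> x) \<le> C j" by metis
  have "norm (connection \<gamma> x) * (1 + x\<^sup>2)\<^sup>2 \<le> C 0 + 2 * C 2 + C 4" for x
  proof -
    have "norm (connection \<gamma> x) * (1 + x\<^sup>2)\<^sup>2 =
      \<bar>x\<bar> ^ 0 * norm (vderivs 1 \<gamma> x) + 2 * (\<bar>x\<bar> ^ 2 * norm (vderivs 1 \<gamma> x)) + \<bar>x\<bar> ^ 4 * norm (vderivs 1 \<gamma> x)"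
      unfolding connection_def norm_orbitM_mult[OF orbitM_C_a]
      by (simp add: power_even_abs algebra_simps power2_eq_square power4_eq_xxxx del: vderivs.simps One_nat_def)
    then show ?thesis using C[of x 0] C[of x 2] C[of x 4] by linarith
  qed
  then show ?thesis by blast
qed

text \<open>Skewness of the connection makes the product constant, and its limit is the identity.
  With \<open>h = g\<close> this is unitarity of a solution, with two solutions it is
  uniqueness.\<close>

lemma parallel_pair_constant:
  assumes "\<And>x. (g has_vector_derivative connection \<gamma> x ** g x) (at x)"
    and "\<And>x. (h has_vector_derivative connection \<gamma> x ** h x) (at x)"
    and "(g \<longlongrightarrow> mat 1) at_bot" "(h \<longlongrightarrow> mat 1) at_bot"
  shows "ctrans (g x) ** h x = mat 1"
proof (rule constant_of_tendsto_at_bot[where f = "\<lambda>x. ctrans (g x) ** h x"])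
  fix x
  have "((\<lambda>x. ctrans (g x) ** h x) has_vector_derivative
      ctrans (g x) ** (connection \<gamma> x ** h x) + ctrans (connection \<gamma> x ** g x) ** h x) (at x)"
    by (intro has_vector_derivative_mat_mult has_vector_derivative_ctrans assms)
  then show "((\<lambda>x. ctrans (g x) ** h x) has_vector_derivative 0) (at x)"
    by (simp add: ctrans_mult connection_skew mat_algebra)
next
  have "((\<lambda>x. ctrans (g x) ** h x) \<longlongrightarrow> ctrans (mat 1) ** mat 1) at_bot"
    by (intro mat_mult.tendsto bounded_linear.tendsto[OF bounded_linear_ctrans] assms)
  then show "((\<lambda>x. ctrans (g x) ** h x) \<longlongrightarrow> mat 1) at_bot" by simp
qed

text \<open>Trades the nonlinear conditions on a frame for a linear initial value problem at minus
  infinity. Forwards, differentiating the conjugation formula for \<open>\<gamma>\<close> identifies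
  the connection, because \<open>v x\<close> anticommutes with \<open>a_pt\<close>; backwards,
  unitarity and the formula follow from two conserved quantities.\<close>

lemma dev_frame_iff:
  "dev_frame \<gamma> g \<longleftrightarrow>
    (\<forall>x. (g has_vector_derivative connection \<gamma> x ** g x) (at x)) \<and> (g \<longlongrightarrow> mat 1) at_bot"
proof
  assume g: "dev_frame \<gamma> g"
  then have un: "unitary (g x)" for x by (simp add: dev_frame_def)
  note inv = matrix_inv_unitary[OF un] and can = unitary_cancel[OF un]
  define v where "v x = ctrans (g x) ** vderivs 1 g x" for x
  have g': "(g has_vector_derivative g x ** v x) (at x)" for x
    using g smooth_fun_has_vector_derivative[of g 0 x] by (simp add: dev_frame_def v_def can)
  have \<gamma>g: "\<gamma> x = g x ** a_pt ** ctrans (g x)" for x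
    using g by (simp add: dev_frame_def inv)
  have v: "v x \<in> u_perp" for x
    using g by (simp add: dev_frame_def inv v_def)
  have "connection \<gamma> x ** g x = g x ** v x" for x
  proof -
    have "((\<lambda>x. g x ** a_pt ** ctrans (g x)) has_vector_derivative
       g x ** a_pt ** ctrans (g x ** v x) + g x ** v x ** a_pt ** ctrans (g x)) (at x)"
      using has_vector_derivative_mat_mult[OF has_vector_derivative_mat_mult[OF g' has_vector_derivative_const[of a_pt]]
         has_vector_derivative_ctrans[OF g']]
      by simp
    then have "(\<gamma> has_vector_derivative
       g x ** a_pt ** ctrans (g x ** v x) + g x ** v x ** a_pt ** ctrans (g x)) (at x)"
      by (simp only: \<gamma>g[symmetric])
    then have "vderivs 1 \<gamma> x = g x ** a_pt ** ctrans (g x ** v x) + g x ** v x ** a_pt ** ctrans (g x)"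
      using C_a_deriv vector_derivative_unique_at by blast
    also have "g x ** a_pt ** ctrans (g x ** v x) = g x ** v x ** a_pt ** ctrans (g x)"
      using v[of x] by (simp add: u_perp_iff ctrans_mult mat_algebra mat_mult_assoc_subst[of "v x" a_pt])
    finally have p: "vderivs 1 \<gamma> x = 2 *\<^sub>R (g x ** v x ** a_pt ** ctrans (g x))"
      by (simp only: scaleR_2)
    have "connection \<gamma> x = g x ** v x ** ctrans (g x)"
      using v[of x] unfolding connection_def p u_perp_iff
      by (simp add: \<gamma>g mat_algebra can a_pt_square[THEN mat_mult_assoc_subst] mat_mult_assoc_subst[of "v x" a_pt])
    then show ?thesis by (simp add: mat_algebra can)
  qed
  then show "(\<forall>x. (g has_vector_derivative connection \<gamma> x ** g x) (at x)) \<and> (g \<longlongrightarrow> mat 1) at_bot"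
    using g g' by (simp add: dev_frame_def)
next
  assume "(\<forall>x. (g has_vector_derivative connection \<gamma> x ** g x) (at x)) \<and> (g \<longlongrightarrow> mat 1) at_bot"
  then have g: "\<And>x. (g has_vector_derivative connection \<gamma> x ** g x) (at x)" and lim: "(g \<longlongrightarrow> mat 1) at_bot" by auto
  have un: "unitary (g x)" for x
    by (rule unitaryI) (rule parallel_pair_constant[OF g g lim lim])
  note inv = matrix_inv_unitary[OF un] and can = unitary_cancel[OF un]
  \<comment> \<open>The derivative is a conjugate of the velocity of \<open>\<gamma>\<close> minus
    the commutator of the connection with \<open>\<gamma>\<close>, hence 0; the limit at minus
    infinity identifies the constant.\<close>
  have conj: "ctrans (g x) ** \<gamma> x ** g x = a_pt" for x
  proof (rule constant_of_tendsto_at_bot[where f = "\<lambda>x. ctrans (g x) ** \<gamma> x ** g x"])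
    fix x
    have "((\<lambda>x. ctrans (g x) ** \<gamma> x ** g x) has_vector_derivative
      ctrans (g x) ** \<gamma> x ** (connection \<gamma> x ** g x) +
      (ctrans (g x) ** vderivs 1 \<gamma> x + ctrans (connection \<gamma> x ** g x) ** \<gamma> x) ** g x) (at x)"
      by (intro has_vector_derivative_mat_mult has_vector_derivative_ctrans g C_a_deriv)
    moreover have "ctrans (g x) ** \<gamma> x ** (connection \<gamma> x ** g x) +
      (ctrans (g x) ** vderivs 1 \<gamma> x + ctrans (connection \<gamma> x ** g x) ** \<gamma> x) ** g x = 0"
      unfolding connection_commutator[symmetric]
      by (simp add: ctrans_mult connection_skew mat_algebra)
    ultimately show "((\<lambda>x. ctrans (g x) ** \<gamma> x ** g x) has_vector_derivative 0) (at x)" by simp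
  next
    have "((\<lambda>x. ctrans (g x) ** \<gamma> x ** g x) \<longlongrightarrow> ctrans (mat 1) ** a_pt ** mat 1) at_bot"
      by (intro mat_mult.tendsto bounded_linear.tendsto[OF bounded_linear_ctrans] lim tendsto_C_a)
    then show "((\<lambda>x. ctrans (g x) ** \<gamma> x ** g x) \<longlongrightarrow> a_pt) at_bot" by simp
  qed
  have "\<gamma> x = g x ** a_pt ** ctrans (g x)" for x
    unfolding conj[of x, symmetric] by (simp add: mat_algebra can)
  moreover have "ctrans (g x) ** (connection \<gamma> x ** g x) \<in> u_perp" for x
    unfolding u_perp_iff conj[of x, symmetric]
    by (simp add: ctrans_mult connection_skew mat_algebra can connection_anticommute[THEN mat_mult_assoc_subst])
  ultimately show "dev_frame \<gamma> g"
    unfolding dev_frame_def vderivs_1I[OF g]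
    using smooth_fun_linear_ode[OF smooth_connection g] by (simp add: un inv lim)
qed

lemma dev_frame_exists: "\<exists>g. dev_frame \<gamma> g"
  unfolding dev_frame_iff
  using connection_decay linear_ode_exists_at_bot[OF smooth_fun_continuous[OF smooth_connection]] by metis

text \<open>Uniqueness of the frame resolves the definite description in \<open>Phi\<close>.\<close>

lemma Phi_eq:
  assumes "dev_frame \<gamma> g"
  shows "Phi \<gamma> x = ctrans (g x) ** connection \<gamma> x ** g x"
proof -
  have un: "unitary (g x)" for x using assms by (simp add: dev_frame_def)
  have g: "\<And>x. (g has_vector_derivative connection \<gamma> x ** g x) (at x)" "(g \<longlongrightarrow> mat 1) at_bot"
    using assms by (simp_all add: dev_frame_iff)
  have "h = g" if "dev_frame \<gamma> h" for h
  proof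
    fix x
    have h: "\<And>x. (h has_vector_derivative connection \<gamma> x ** h x) (at x)" "(h \<longlongrightarrow> mat 1) at_bot"
      using that by (simp_all add: dev_frame_iff)
    have "g x ** (ctrans (g x) ** h x) = g x"
      unfolding parallel_pair_constant[OF g(1) h(1) g(2) h(2)] by simp
    then show "h x = g x" by (simp add: unitary_cancel[OF un])
  qed
  then have "Phi \<gamma> = (\<lambda>x. matrix_inv (g x) ** vderivs 1 g x)"
    unfolding Phi_def using assms by (intro the_equality) blast+
  then show ?thesis
    by (simp add: vderivs_1I[OF g(1)] matrix_inv_unitary[OF un] mat_algebra del: vderivs.simps One_nat_def)
qed

end

section \<open>Propagation of bounds\<close>

lemma compact_locally_bounded:
  fixes M :: "'i \<Rightarrow> real \<Rightarrow> real"
  assumes "compact S" "\<And>t. t \<in> S \<Longrightarrow> \<exists>d>0. \<exists>K. \<forall>y. \<forall>\<tau>\<in>ball t d. M y \<tau> \<le> K"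
  shows "\<exists>K. \<forall>y. \<forall>t\<in>S. M y t \<le> K"
proof -
  obtain d K where dK: "\<And>t. t \<in> S \<Longrightarrow> d t > 0 \<and> (\<forall>y. \<forall>\<tau>\<in>ball t (d t). M y \<tau> \<le> K t)"
    using assms(2) by metis
  obtain T where T: "T \<subseteq> S" "finite T" "S \<subseteq> (\<Union>t\<in>T. ball t (d t))"
  proof (rule compactE_image[OF assms(1), of S "\<lambda>t. ball t (d t)"])
    show "S \<subseteq> (\<Union>t\<in>S. ball t (d t))"
      using dK by (meson UN_I centre_in_ball subsetI)
  qed auto
  have "M y t \<le> (\<Sum>\<tau>\<in>T. \<bar>K \<tau>\<bar>)" if "t \<in> S" for y t
  proof -
    obtain \<tau> where "\<tau> \<in> T" "t \<in> ball \<tau> (d \<tau>)" using T(3) \<open>t \<in> S\<close> by blast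
    then have "M y t \<le> \<bar>K \<tau>\<bar>" using dK T(1) by (meson abs_ge_self order.trans subsetD)
    also have "\<dots> \<le> (\<Sum>\<tau>\<in>T. \<bar>K \<tau>\<bar>)" using T(2) \<open>\<tau> \<in> T\<close> by (intro member_le_sum) auto
    finally show ?thesis .
  qed
  then show ?thesis by blast
qed

text \<open>If the points without a bounded neighbourhood formed a nonempty closed set, then by Baire's theorem the
  family would be bounded on a portion of that set, and propagation would carry the bound into the gaps.\<close>

lemma propagation_imp_locally_bounded:
  fixes M :: "'i \<Rightarrow> real \<Rightarrow> real"
  assumes cont: "\<And>y. continuous_on UNIV (M y)"
    and fin: "\<And>t. \<exists>K. \<forall>y. M y t \<le> K"
    and propagation: "\<And>a b. \<exists>C. \<forall>s\<in>{a..b}. \<forall>t\<in>{a..b}. \<forall>K N. (\<forall>y. \<forall>\<tau>\<in>closed_segment s t. M y \<tau> \<le> K)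
       \<longrightarrow> (\<forall>y. M y s \<le> N) \<longrightarrow> (\<forall>y. M y t \<le> N + C)"
  shows "\<exists>K. \<forall>y. \<forall>t\<in>{a..b}. M y t \<le> K"
proof -
  define LB where "LB t \<longleftrightarrow> (\<exists>d>0. \<exists>K. \<forall>y. \<forall>\<tau>\<in>ball t d. M y \<tau> \<le> K)" for t
  have openLB: "open {t. LB t}"
    unfolding open_dist
  proof clarify
    fix t assume "LB t"
    then obtain d K where d: "d > 0" and K: "\<And>y \<tau>. \<tau> \<in> ball t d \<Longrightarrow> M y \<tau> \<le> K"
      unfolding LB_def by blast
    have "LB s" if "dist s t < d" for s
      unfolding LB_def
    proof (intro exI conjI allI ballI)
      show "d - dist s t > 0" using that by simp
      fix y \<tau> assume "\<tau> \<in> ball s (d - dist s t)"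
      then have "dist t \<tau> < d" using dist_triangle[of t \<tau> s] by (simp add: dist_commute)
      then show "M y \<tau> \<le> K" by (intro K) simp
    qed
    then show "\<exists>e>0. \<forall>y. dist y t < e \<longrightarrow> y \<in> {t. LB t}" using d by blast
  qed
  define S where "S = {t. \<not> LB t}"
  have closedS: "closed S"
    using openLB unfolding S_def closed_def by (simp add: Compl_eq)
  have "S = {}"
  proof (rule ccontr)
    assume "S \<noteq> {}"
    \<comment> \<open>Relatively open in \<open>S\<close> by continuity, and with empty intersection
      by pointwise finiteness; by Baire one of these sets is not dense in \<open>S\<close>, which
      yields the portion around \<open>t0\<close>.\<close>
    define G where "G n = {t\<in>S. \<exists>y. real n < M y t}" for n :: nat
    have "openin (top_of_set S) (G n)" for n
    proof -
      have "G n = (\<Union>y. S \<inter> (M y -` {real n<..}))" by (auto simp: G_def)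
      moreover have "open (M y -` {real n<..})" for y
        by (rule open_vimage[OF open_greaterThan cont])
      ultimately show ?thesis by (auto intro!: openin_open_Int)
    qed
    moreover have "\<Inter>(range G) = {}"
    proof -
      have "t \<notin> \<Inter>(range G)" for t
      proof -
        obtain K where "\<And>y. M y t \<le> K" using fin by blast
        moreover obtain n where "K \<le> real n" using real_arch_simple by blast
        ultimately have "t \<notin> G n" unfolding G_def by (auto simp: not_less intro: order.trans)
        then show ?thesis by blast
      qed
      then show ?thesis by blast
    qed
    ultimately have "\<exists>n. \<not> S \<subseteq> closure (G n)"
      using Baire[OF closedS, of "range G"] \<open>S \<noteq> {}\<close> by auto
    then obtain n t0 where t0: "t0 \<in> S" "t0 \<notin> closure (G n)" by blast
    then obtain e where e: "e > 0" "ball t0 e \<inter> G n = {}"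
      unfolding closure_iff_nhds_not_empty by (metis centre_in_ball disjoint_iff open_ball open_contains_ball subsetD UNIV_I closure_approachable dist_commute mem_ball)
    have portion: "M y t \<le> real n" if "t \<in> ball t0 e" "t \<in> S" for y t
      using e(2) that unfolding G_def by (metis (mono_tags, lifting) IntI empty_iff mem_Collect_eq not_less)
    obtain C where C: "\<And>s t K N y. s \<in> {t0-e..t0+e} \<Longrightarrow> t \<in> {t0-e..t0+e} \<Longrightarrow>
         (\<forall>y. \<forall>\<tau>\<in>closed_segment s t. M y \<tau> \<le> K) \<Longrightarrow> (\<forall>y. M y s \<le> N) \<Longrightarrow> M y t \<le> N + C"
      using propagation[of "t0-e" "t0+e"] by blast
    have seg: "closed_segment s t \<subseteq> ball t0 e" if "s \<in> ball t0 e" "t \<in> ball t0 e" for s t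
      using that by (simp add: closed_segment_subset)
    have ivl: "t \<in> {t0-e..t0+e}" if "t \<in> ball t0 e" for t using that by (auto simp: dist_real_def)
    have "M y t \<le> real n + \<bar>C\<bar>" if t: "t \<in> ball t0 e" for y t
    proof (cases "t \<in> S")
      case True then show ?thesis using portion[OF t True, of y] by simp
    next
      case False
      have t0b: "t0 \<in> ball t0 e" using e(1) by simp
      \<comment> \<open>Take the point of \<open>S\<close> on the segment that is nearest to t; past
        it the family is locally bounded.\<close>
      have "compact (S \<inter> closed_segment t0 t)" by (simp add: closedS closed_Int_compact)
      moreover have "t0 \<in> S \<inter> closed_segment t0 t" using t0 by simp
      ultimately obtain \<alpha> where \<alpha>: "\<alpha> \<in> S \<inter> closed_segment t0 t"
        "\<And>\<beta>. \<beta> \<in> S \<inter> closed_segment t0 t \<Longrightarrow> dist t \<alpha> \<le> dist t \<beta>"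
        using distance_attains_inf[of "S \<inter> closed_segment t0 t" t] compact_imp_closed by blast
      have \<alpha>b: "\<alpha> \<in> ball t0 e" using \<alpha>(1) seg[OF t0b t] by blast
      have gap: "LB \<tau>" if "\<tau> \<in> closed_segment \<alpha> t" "\<tau> \<noteq> \<alpha>" for \<tau>
      proof -
        have "\<tau> \<in> closed_segment t0 t" "dist t \<tau> < dist t \<alpha>"
          using that \<alpha>(1) by (auto simp: closed_segment_eq_real_ivl dist_real_def split: if_splits)
        then show ?thesis using \<alpha>(2) S_def by force
      qed
      obtain Nt where Nt: "\<And>y. M y t \<le> Nt" using fin by blast
      obtain N\<alpha> where N\<alpha>: "\<And>y. M y \<alpha> \<le> N\<alpha>" using fin by blast
      \<comment> \<open>Backwards from t: on the compact piece between t and \<tau> some bound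
        exists, and since \<open>C\<close> does not depend on its size, one estimate serves all
        \<tau> up to but excluding \<alpha>.\<close>
      have "M y \<tau> \<le> Nt + C" if "\<tau> \<in> closed_segment \<alpha> t" "\<tau> \<noteq> \<alpha>" for \<tau> y
      proof -
        have "closed_segment t \<tau> \<subseteq> closed_segment \<alpha> t - {\<alpha>}"
          using that by (auto simp: closed_segment_eq_real_ivl split: if_splits)
        then have "\<exists>K. \<forall>y. \<forall>t\<in>closed_segment t \<tau>. M y t \<le> K"
          using gap by (intro compact_locally_bounded) (auto simp: LB_def)
        then obtain K where "\<forall>y. \<forall>t\<in>closed_segment t \<tau>. M y t \<le> K" by blast
        moreover have "\<tau> \<in> ball t0 e" using that seg[OF \<alpha>b t] by blast
        ultimately show ?thesis using C[of t \<tau> K Nt y] ivl t Nt by blast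
      qed
      then have "\<forall>y. \<forall>\<tau>\<in>closed_segment \<alpha> t. M y \<tau> \<le> max N\<alpha> (Nt + C)"
        using N\<alpha> by (metis max.coboundedI1 max.coboundedI2)
      \<comment> \<open>Forwards from \<alpha>, where the bound \<open>n\<close> of the portion
        holds. The uncontrolled numbers \<open>Nt\<close> and \<open>N\<alpha>\<close> enter only
        through the a priori bound on the segment.\<close>
      then have "M y t \<le> real n + C"
        using C[of \<alpha> t _ "real n" y] ivl[OF \<alpha>b] ivl[OF t] portion[OF \<alpha>b] \<alpha>(1) by blast
      then show ?thesis by linarith
    qed
    then have "LB t0" unfolding LB_def using e(1) by blast
    then show False using t0 by (simp add: S_def)
  qed
  then show ?thesis
    by (intro compact_locally_bounded) (auto simp: S_def LB_def)
qed

text \<open>Otherwise \<open>P y - \<delta> * y\<close> would be nondecreasing from \<open>Y\<close>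
  on and \<open>P\<close> would exceed \<open>K\<close>.\<close>

lemma bounded_primitive_small:
  fixes P :: "real \<Rightarrow> real"
  assumes dP: "\<And>y. y > 0 \<Longrightarrow> (P has_real_derivative \<rho> y) (at y)" and bound: "\<And>y. P y \<le> K" and "\<delta> > 0" "Y > 0"
  shows "\<exists>y\<ge>Y. \<rho> y < \<delta>"
proof (rule ccontr)
  assume "\<not> ?thesis"
  then have ge: "\<rho> y \<ge> \<delta>" if "y \<ge> Y" for y using that by (auto simp: not_less)
  define y where "y = Y + (\<bar>K - P Y\<bar> + 1) / \<delta>"
  have "Y \<le> y" using \<open>\<delta> > 0\<close> by (simp add: y_def)
  then have "P Y - \<delta> * Y \<le> P y - \<delta> * y"
  proof (rule DERIV_nonneg_imp_nondecreasing)
    fix z assume "Y \<le> z"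
    have "((\<lambda>y. P y - \<delta> * y) has_real_derivative \<rho> z - \<delta>) (at z)"
      using \<open>Y \<le> z\<close> \<open>Y > 0\<close> by (auto intro!: derivative_eq_intros dP)
    then show "\<exists>d. ((\<lambda>y. P y - \<delta> * y) has_real_derivative d) (at z) \<and> 0 \<le> d"
      using ge[OF \<open>Y \<le> z\<close>] by (intro exI[of _ "\<rho> z - \<delta>"]) simp
  qed
  moreover have "\<delta> * (y - Y) = \<bar>K - P Y\<bar> + 1" using \<open>\<delta> > 0\<close> by (simp add: y_def)
  ultimately show False using bound[of y] by (simp add: algebra_simps)
qed

text \<open>The assumption on \<open>n\<close> expresses \<open>n\<^sup>2 \<le> \<rho> k\<close>. If \<open>n\<close> stayed above \<open>\<delta>\<close>,
  then \<open>m\<close> would grow faster than any linear function, so \<open>m \<le> 2 n\<close> eventually, and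
  \<open>m\<^sup>2 \<le> 4 \<rho> m'\<close> makes \<open>m\<close> blow up at a finite point.\<close>

lemma flux_liminf_zero:
  fixes P m n \<rho> k :: "real \<Rightarrow> real"
  assumes dP: "\<And>y. y > 0 \<Longrightarrow> (P has_real_derivative \<rho> y) (at y)" and bound: "\<And>y. P y \<le> K"
    and dm: "\<And>y. y > 0 \<Longrightarrow> (m has_real_derivative k y) (at y)"
    and n: "\<And>y \<mu>. \<mu> > 0 \<Longrightarrow> 2 * n y \<le> \<mu> * \<rho> y + k y / \<mu>"
    and m_le: "\<And>y. y \<ge> 0 \<Longrightarrow> m y \<le> C + D * y + n y"
    and "\<delta> > 0" "Y > 0"
  shows "\<exists>y\<ge>Y. n y < \<delta>"
proof (rule ccontr)
  assume "\<not> ?thesis"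
  then have ge: "n y \<ge> \<delta>" if "y \<ge> Y" for y using that by (auto simp: not_less)
  \<comment> \<open>Chosen so that \<open>m\<close> grows at least at the rate
    \<open>2 * \<delta> * \<mu>\<close>, twice what the linear term of \<open>m_le\<close> can
    account for.\<close>
  define \<mu> where "\<mu> = (\<bar>D\<bar> + 1) / \<delta>"
  have \<mu>: "\<mu> > 0" "\<delta> * \<mu> = \<bar>D\<bar> + 1" using \<open>\<delta> > 0\<close> by (simp_all add: \<mu>_def add_pos_nonneg)
  define E where "E = 2 * (\<bar>D\<bar> + 1) * Y + \<mu>\<^sup>2 * (K - P Y) - m Y"
  have grow: "m y \<ge> 2 * (\<bar>D\<bar> + 1) * y - E" if "y \<ge> Y" for y
  proof -
    have "\<mu> * P Y + m Y / \<mu> - 2 * \<delta> * Y \<le> \<mu> * P y + m y / \<mu> - 2 * \<delta> * y"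
      using that
    proof (rule DERIV_nonneg_imp_nondecreasing)
      fix z assume "Y \<le> z"
      have "((\<lambda>y. \<mu> * P y + m y / \<mu> - 2 * \<delta> * y) has_real_derivative \<mu> * \<rho> z + k z / \<mu> - 2 * \<delta>) (at z)"
        using \<mu>(1) \<open>Y \<le> z\<close> \<open>Y > 0\<close> by (auto intro!: derivative_eq_intros dP dm)
      then show "\<exists>d. ((\<lambda>y. \<mu> * P y + m y / \<mu> - 2 * \<delta> * y) has_real_derivative d) (at z) \<and> 0 \<le> d"
        using n[OF \<mu>(1), of z] ge[OF \<open>Y \<le> z\<close>] by (intro exI[of _ "\<mu> * \<rho> z + k z / \<mu> - 2 * \<delta>"]) simp
    qed
    then have *: "\<mu> * (\<mu> * P Y + m Y / \<mu> - 2 * \<delta> * Y) \<le> \<mu> * (\<mu> * P y + m y / \<mu> - 2 * \<delta> * y)"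
      using \<mu>(1) by simp
    have **: "\<mu> * (\<mu> * P z + m z / \<mu> - 2 * \<delta> * z) = \<mu>\<^sup>2 * P z + m z - 2 * (\<bar>D\<bar> + 1) * z" for z
      unfolding \<mu>(2)[symmetric] using \<mu>(1) by (simp add: algebra_simps power2_eq_square)
    have "\<mu>\<^sup>2 * P y \<le> \<mu>\<^sup>2 * K" using bound by (simp add: mult_left_mono)
    then show ?thesis using *[unfolded **] by (simp add: E_def right_diff_distrib)
  qed
  \<comment> \<open>Beyond this point half of \<open>m y\<close> exceeds \<open>C + D * y\<close>,
    so the other half must be carried by \<open>n y\<close>.\<close>
  define Z where "Z = max Y (max 0 (\<bar>E\<bar> + \<bar>C\<bar> + 1))"
  have big: "m y > 0" "m y \<le> 2 * n y" if "y \<ge> Z" for y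
  proof -
    have y: "y \<ge> Y" "y \<ge> 0" "y \<ge> \<bar>E\<bar> + \<bar>C\<bar> + 1" using that by (auto simp: Z_def)
    have D: "D * y \<le> \<bar>D\<bar> * y" "0 \<le> \<bar>D\<bar> * y" using y by (auto intro: mult_right_mono)
    have g: "m y \<ge> 2 * (\<bar>D\<bar> * y) + 2 * y - E" using grow[OF y(1)] by (simp add: algebra_simps)
    show "m y > 0" using g D y by linarith
    show "m y \<le> 2 * n y" using g D y m_le[OF y(2)] by linarith
  qed
  \<comment> \<open>The weight in assumption \<open>n\<close> is now \<open>m z\<close> itself:
    dividing by \<open>m z\<close> gives \<open>1 \<le> \<rho> z + k z / (m z)^2\<close>, and the
    last term is the derivative of \<open>- 1 / m\<close>. Both \<open>P\<close> and
    \<open>- 1 / m\<close> are bounded above, so their sum cannot keep growing.\<close>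
  have nondec: "P Z - 1 / m Z - Z \<le> P y - 1 / m y - y" if "Z \<le> y" for y
    using that
  proof (rule DERIV_nonneg_imp_nondecreasing)
    fix z assume "Z \<le> z"
    note b = big[OF this]
    have "m z \<le> m z * \<rho> z + k z / m z" using n[OF b(1), of z] b by linarith
    then have "m z * 1 \<le> m z * (\<rho> z + k z / (m z)\<^sup>2)"
      using b(1) by (simp add: algebra_simps power2_eq_square)
    then have "1 \<le> \<rho> z + k z / (m z)\<^sup>2" using b(1) by (simp only: mult_le_cancel_left_pos)
    moreover have "((\<lambda>y. P y - 1 / m y - y) has_real_derivative \<rho> z + k z / (m z)\<^sup>2 - 1) (at z)"
      using b(1) \<open>Z \<le> z\<close> \<open>Y > 0\<close> by (auto intro!: derivative_eq_intros dP dm simp: power2_eq_square Z_def)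
    ultimately show "\<exists>d. ((\<lambda>y. P y - 1 / m y - y) has_real_derivative d) (at z) \<and> 0 \<le> d"
      by (intro exI[of _ "\<rho> z + k z / (m z)\<^sup>2 - 1"]) simp
  qed
  define y where "y = max Z (K - (P Z - 1 / m Z - Z) + 1)"
  have y: "y \<ge> Z" "y \<ge> K - (P Z - 1 / m Z - Z) + 1" by (simp_all add: y_def)
  have "1 / m y > 0" using big(1)[OF y(1)] by simp
  then show False using nondec[OF y(1)] bound[of y] y(2) by linarith
qed

section \<open>Conservation laws of the flow\<close>

lemma inner_skew_mult: "ctrans K = - K \<Longrightarrow> X \<bullet> (K ** X) = 0"
  using inner_mult_adjoint_left[of X K X] by (simp add: mat_distribs inner_commute)

lemma skew_has_vector_derivative:
  assumes "(f has_vector_derivative f') (at x)" "\<And>y. ctrans (f y) = - f y"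
  shows "ctrans f' = - f'"
proof -
  have "((\<lambda>x. - f x) has_vector_derivative ctrans f') (at x)"
    using has_vector_derivative_ctrans[OF assms(1)] by (simp add: assms(2))
  then show ?thesis
    using has_vector_derivative_minus[OF assms(1)] vector_derivative_unique_at by blast
qed

lemma skew_mult_self: "ctrans K = - K \<Longrightarrow> ctrans (K ** K) = K ** K"
  by (simp add: ctrans_mult mat_distribs)

locale gnls_flow =
  fixes \<gamma> :: "real \<Rightarrow> real \<Rightarrow> ('k::finite, 'm::finite) mat"
  assumes smooth: "smooth2 \<gamma>"
    and inCa: "\<And>t. (\<lambda>x. \<gamma> x t) \<in> C_a"
    and GNLS: "\<And>x t. ((\<lambda>s. \<gamma> x s) has_vector_derivative
                  comm (\<gamma> x t) (vderivs 2 (\<lambda>y. \<gamma> y t) x)) (at t)"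
begin

section \<open>Derivatives of the flow and the relations among them\<close>

definition "p = pd 1 0 \<gamma>"
definition "r = pd 2 0 \<gamma>"
definition "s = pd 3 0 \<gamma>"
definition "w = pd 0 1 \<gamma>"
definition "wx = pd 1 1 \<gamma>"
definition "wxx = pd 2 1 \<gamma>"
definition "wt = pd 0 2 \<gamma>"

lemmas pd_defs = p_def r_def s_def w_def wx_def wxx_def wt_def

lemma pd_00: "pd 0 0 \<gamma> = \<gamma>"
  by (simp add: pd_def fun_eq_iff)

lemma pd_dx: "((\<lambda>y. pd i j \<gamma> y t) has_vector_derivative pd (Suc i) j \<gamma> x t) (at x)"
  and pd_dt: "((\<lambda>\<tau>. pd i j \<gamma> x \<tau>) has_vector_derivative pd i (Suc j) \<gamma> x t) (at t)"
  and pd_cont: "continuous_on UNIV (\<lambda>(x, t). pd i j \<gamma> x t)"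
  using smooth by (auto simp: smooth2_def)

lemma dx:
  "((\<lambda>y. \<gamma> y t) has_vector_derivative p x t) (at x)"
  "((\<lambda>y. p y t) has_vector_derivative r x t) (at x)"
  "((\<lambda>y. r y t) has_vector_derivative s x t) (at x)"
  "((\<lambda>y. w y t) has_vector_derivative wx x t) (at x)"
  "((\<lambda>y. wx y t) has_vector_derivative wxx x t) (at x)"
  using pd_dx[of 0 0] pd_dx[of 1 0] pd_dx[of 2 0] pd_dx[of 0 1] pd_dx[of 1 1]
  by (simp_all add: pd_00 pd_defs eval_nat_numeral)

lemma dt:
  "((\<lambda>\<tau>. \<gamma> x \<tau>) has_vector_derivative w x t) (at t)"
  "((\<lambda>\<tau>. p x \<tau>) has_vector_derivative wx x t) (at t)"
  "((\<lambda>\<tau>. r x \<tau>) has_vector_derivative wxx x t) (at t)"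
  "((\<lambda>\<tau>. w x \<tau>) has_vector_derivative wt x t) (at t)"
  using pd_dt[of 0 0] pd_dt[of 1 0] pd_dt[of 2 0] pd_dt[of 0 1]
  by (simp_all add: pd_00 pd_defs eval_nat_numeral)

lemma vderivs_x: "vderivs i (\<lambda>y. \<gamma> y t) x = pd i 0 \<gamma> x t"
  by (simp add: pd_def)

lemma \<gamma>_orbit: "\<gamma> x t \<in> orbitM"
  using orbitM_C_a[OF inCa] .

lemma pd_skew: "ctrans (pd i j \<gamma> x t) = - pd i j \<gamma> x t"
proof (induction i arbitrary: x t)
  case 0
  show ?case
  proof (induction j arbitrary: x t)
    case 0
    show ?case by (simp add: pd_00 orbitM_skew[OF \<gamma>_orbit])
  next
    case (Suc j)
    show ?case by (rule skew_has_vector_derivative[OF pd_dt Suc])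
  qed
next
  case (Suc i)
  show ?case by (rule skew_has_vector_derivative[OF pd_dx Suc])
qed

lemma \<gamma>_skew: "ctrans (\<gamma> x t) = - \<gamma> x t"
  using pd_skew[of 0 0] by (simp add: pd_00)

lemma skew:
  "ctrans (p x t) = - p x t" "ctrans (r x t) = - r x t" "ctrans (wx x t) = - wx x t"
  "ctrans (w x t) = - w x t"
  unfolding pd_defs by (rule pd_skew)+

lemma \<gamma>\<gamma>: "\<gamma> x t ** \<gamma> x t = - (1/4) *\<^sub>R mat 1"
  by (rule orbitM_square[OF \<gamma>_orbit])

lemma p\<gamma>: "p x t ** \<gamma> x t = - (\<gamma> x t ** p x t)"
  using C_a_deriv_anticommute[OF inCa] unfolding vderivs_x p_def .

lemma r\<gamma>: "r x t ** \<gamma> x t = - 2 *\<^sub>R (p x t ** p x t) - \<gamma> x t ** r x t"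
proof -
  have "((\<lambda>y. p y t ** \<gamma> y t + \<gamma> y t ** p y t) has_vector_derivative
     (p x t ** p x t + r x t ** \<gamma> x t) + (\<gamma> x t ** r x t + p x t ** p x t)) (at x)"
    by (intro has_vector_derivative_add has_vector_derivative_mat_mult dx)
  then have "((\<lambda>y. 0) has_vector_derivative
     (p x t ** p x t + r x t ** \<gamma> x t) + (\<gamma> x t ** r x t + p x t ** p x t)) (at x)"
    by (simp add: p\<gamma>)
  then have "(p x t ** p x t + r x t ** \<gamma> x t) + (\<gamma> x t ** r x t + p x t ** p x t) = 0"
    using vector_derivative_unique_at has_vector_derivative_const by blast
  then show ?thesis
    by (simp add: vec_eq_iff scaleR_conv_of_real) (simp add: algebra_simps eq_neg_iff_add_eq_0)
qed

lemma s\<gamma>: "s x t ** \<gamma> x t = - 3 *\<^sub>R (r x t ** p x t + p x t ** r x t) - \<gamma> x t ** s x t"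
proof -
  have "((\<lambda>y. r y t ** \<gamma> y t + 2 *\<^sub>R (p y t ** p y t) + \<gamma> y t ** r y t) has_vector_derivative
     (r x t ** p x t + s x t ** \<gamma> x t) + 2 *\<^sub>R (p x t ** r x t + r x t ** p x t)
       + (\<gamma> x t ** s x t + p x t ** r x t)) (at x)"
    by (intro has_vector_derivative_add has_vector_derivative_mat_mult dx
      bounded_linear.has_vector_derivative[OF bounded_linear_scaleR_right])
  then have "((\<lambda>y. 0) has_vector_derivative
     (r x t ** p x t + s x t ** \<gamma> x t) + 2 *\<^sub>R (p x t ** r x t + r x t ** p x t)
       + (\<gamma> x t ** s x t + p x t ** r x t)) (at x)"
    by (simp add: r\<gamma>)
  then have "(r x t ** p x t + s x t ** \<gamma> x t) + 2 *\<^sub>R (p x t ** r x t + r x t ** p x t)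
       + (\<gamma> x t ** s x t + p x t ** r x t) = 0"
    using vector_derivative_unique_at has_vector_derivative_const by blast
  then show ?thesis
    by (simp add: vec_eq_iff scaleR_conv_of_real) (simp add: algebra_simps eq_neg_iff_add_eq_0)
qed

lemma w_eq: "w x t = 2 *\<^sub>R (p x t ** p x t) + 2 *\<^sub>R (\<gamma> x t ** r x t)"
proof -
  have "w x t = comm (\<gamma> x t) (r x t)"
    using GNLS dt(1) vector_derivative_unique_at unfolding vderivs_x r_def by blast
  then show ?thesis by (simp add: comm_def r\<gamma> scaleR_2)
qed

text \<open>Successive x-derivatives of the relation for \<open>\<gamma> ** \<gamma>\<close>. They
  move every \<open>\<gamma>\<close> to the left and collapse its square, giving a normal form in
  which identities between words can be compared.\<close>

lemmas words = \<gamma>\<gamma> \<gamma>\<gamma>[THEN mat_mult_assoc_subst] p\<gamma> p\<gamma>[THEN mat_mult_assoc_subst]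
  r\<gamma> r\<gamma>[THEN mat_mult_assoc_subst] s\<gamma> s\<gamma>[THEN mat_mult_assoc_subst]

lemma wx_eq: "wx x t = 2 *\<^sub>R (p x t ** r x t + r x t ** p x t) + 2 *\<^sub>R (\<gamma> x t ** s x t + p x t ** r x t)"
proof -
  have "((\<lambda>x. w x t) has_vector_derivative 2 *\<^sub>R (p x t ** r x t + r x t ** p x t)
     + 2 *\<^sub>R (\<gamma> x t ** s x t + p x t ** r x t)) (at x)"
    unfolding w_eq by (intro has_vector_derivative_add has_vector_derivative_mat_mult dx
      bounded_linear.has_vector_derivative[OF bounded_linear_scaleR_right])
  then show ?thesis by (rule vector_derivative_unique_at[OF dx(4)])
qed

lemma wt_eq: "wt x t = 2 *\<^sub>R (p x t ** wx x t + wx x t ** p x t) + 2 *\<^sub>R (\<gamma> x t ** wxx x t + w x t ** r x t)"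
proof -
  have "((\<lambda>\<tau>. 2 *\<^sub>R (p x \<tau> ** p x \<tau>) + 2 *\<^sub>R (\<gamma> x \<tau> ** r x \<tau>)) has_vector_derivative
     2 *\<^sub>R (p x t ** wx x t + wx x t ** p x t) + 2 *\<^sub>R (\<gamma> x t ** wxx x t + w x t ** r x t)) (at t)"
    by (intro has_vector_derivative_add has_vector_derivative_mat_mult dt
      bounded_linear.has_vector_derivative[OF bounded_linear_scaleR_right])
  then show ?thesis
    unfolding w_eq[symmetric] by (rule vector_derivative_unique_at[OF dt(4)])
qed

definition A where "A x t = 2 *\<^sub>R (\<gamma> x t ** p x t)"
definition At where "At x t = 2 *\<^sub>R (\<gamma> x t ** wx x t + w x t ** p x t)"
text \<open>The expression \<open>2 \<gamma> w + 2 \<gamma> A A\<close> of \<open>B_eq\<close> with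
  the flow inserted, that is, \<open>Q2\<close> carried back by the frame.\<close>

definition B where "B x t = 6 *\<^sub>R (\<gamma> x t ** (p x t ** p x t)) - r x t"
definition Bx where "Bx x t = 6 *\<^sub>R (\<gamma> x t ** (p x t ** r x t + r x t ** p x t) + p x t ** (p x t ** p x t)) - s x t"

lemma connection_eq: "connection (\<lambda>y. \<gamma> y t) x = A x t"
  unfolding connection_def A_def vderivs_x p_def ..

lemma A_skew: "ctrans (A x t) = - A x t"
  using connection_skew[OF inCa] unfolding connection_eq .

text \<open>The flow in divergence form. Thus \<open>w\<close> is both the time derivative of
  \<open>\<gamma>\<close> and the space derivative of \<open>A\<close>, and it plays the role of the
  x-derivative of u.\<close>

lemma A_dx: "((\<lambda>y. A y t) has_vector_derivative w x t) (at x)"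
proof -
  have "((\<lambda>y. A y t) has_vector_derivative 2 *\<^sub>R (\<gamma> x t ** r x t + p x t ** p x t)) (at x)"
    unfolding A_def by (intro has_vector_derivative_mat_mult dx
      bounded_linear.has_vector_derivative[OF bounded_linear_scaleR_right])
  then show ?thesis by (simp add: w_eq scaleR_add_right add.commute)
qed

lemma A_dt: "((\<lambda>\<tau>. A x \<tau>) has_vector_derivative At x t) (at t)"
  unfolding A_def At_def by (intro has_vector_derivative_mat_mult dt
      bounded_linear.has_vector_derivative[OF bounded_linear_scaleR_right])

lemma B_dx: "((\<lambda>y. B y t) has_vector_derivative Bx x t) (at x)"
  unfolding B_def Bx_def by (intro has_vector_derivative_diff has_vector_derivative_mat_mult dx
      bounded_linear.has_vector_derivative[OF bounded_linear_scaleR_right])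

text \<open>The compatibility condition of \<open>g_x = A g\<close> and \<open>g_t = B g\<close>;
  with the time derivatives eliminated it is a polynomial identity in \<open>\<gamma>\<close>,
  \<open>p\<close>, \<open>r\<close>, \<open>s\<close>.\<close>

lemma zero_curvature: "Bx x t = At x t + comm (A x t) (B x t)"
  unfolding Bx_def At_def A_def B_def comm_def wx_eq w_eq
  by (simp add: mat_algebra words)
    (simp add: vec_eq_iff scaleR_conv_of_real algebra_simps)

lemma norm_A: "norm (A x t) = norm (p x t)"
  unfolding A_def by (rule norm_orbitM_mult[OF \<gamma>_orbit])

text \<open>The product rule leaves \<open>r \<bullet> w\<close>, which vanishes:
  \<open>p ** p\<close> is Hermitian while \<open>r\<close> is skew, and \<open>\<gamma>\<close> is
  skew. With \<open>mass_dt\<close> this says that the mass density \<open>p \<bullet> p\<close> has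
  flux \<open>2 * (p \<bullet> w)\<close>.\<close>

lemma mass_law: "((\<lambda>y. p y t \<bullet> w y t) has_real_derivative p x t \<bullet> wx x t) (at x)"
proof -
  have "r x t \<bullet> w x t = 0"
    unfolding w_eq inner_add_right inner_scaleR_right
    by (simp add: inner_skew_mult \<gamma>_skew inner_commute[of "r x t" "p x t ** p x t"]
       inner_hermitian_skew skew_mult_self skew)
  moreover have "((\<lambda>y. p y t \<bullet> w y t) has_vector_derivative p x t \<bullet> wx x t + r x t \<bullet> w x t) (at x)"
    by (intro bounded_bilinear.has_vector_derivative[OF bounded_bilinear_inner] dx)
  ultimately show ?thesis by (simp add: has_real_derivative_iff_has_vector_derivative)
qed

lemma mass_dt: "((\<lambda>\<tau>. p x \<tau> \<bullet> p x \<tau>) has_real_derivative 2 * (p x t \<bullet> wx x t)) (at t)"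
  using bounded_bilinear.has_vector_derivative[OF bounded_bilinear_inner dt(2)[of x t] dt(2)[of x t]]
  by (simp add: has_real_derivative_iff_has_vector_derivative inner_commute)

text \<open>The momentum flux of the Schroedinger equation; in terms of u it is |u_x|^2 - |u^2|^2 -
  <u, u_xx>.\<close>

definition h where
  "h x t = w x t \<bullet> w x t - (p x t ** p x t) \<bullet> (p x t ** p x t) - A x t \<bullet> wx x t"

definition ft where "ft x t = p x t \<bullet> wt x t + wx x t \<bullet> w x t"

lemma flux_dt: "((\<lambda>\<tau>. p x \<tau> \<bullet> w x \<tau>) has_real_derivative ft x t) (at t)"
  unfolding ft_def has_real_derivative_iff_has_vector_derivative
  by (intro bounded_bilinear.has_vector_derivative[OF bounded_bilinear_inner] dt)

text \<open>The terms with \<open>wxx\<close> agree by adjointness; what remains on either side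
  reduces to the same multiple of \<open>(p ** (p ** p)) \<bullet> r\<close>.\<close>

lemma momentum_law: "((\<lambda>y. h y t) has_real_derivative ft x t) (at x)"
proof -
  let ?p = "p x t" and ?r = "r x t" and ?g = "\<gamma> x t" and ?w = "w x t" and ?wx = "wx x t" and ?wxx = "wxx x t"
  let ?a = "A x t"
  let ?d = "(?w \<bullet> ?wx + ?wx \<bullet> ?w) - ((?p ** ?p) \<bullet> (?p ** ?r + ?r ** ?p) + (?p ** ?r + ?r ** ?p) \<bullet> (?p ** ?p))
       - (?a \<bullet> ?wxx + ?w \<bullet> ?wx)"
  have d: "((\<lambda>y. h y t) has_vector_derivative ?d) (at x)"
    unfolding h_def
    by (intro has_vector_derivative_diff bounded_bilinear.has_vector_derivative[OF bounded_bilinear_inner]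
       has_vector_derivative_mat_mult dx A_dx)
  have "?p \<bullet> (?p ** ?wx) = - ((?p ** ?p) \<bullet> ?wx)"
    by (simp add: inner_mult_adjoint_left skew mat_distribs)
  moreover have "?p \<bullet> (?wx ** ?p) = - ((?p ** ?p) \<bullet> ?wx)"
    by (simp add: inner_mult_adjoint_right skew mat_distribs)
  moreover have "(?p ** ?p) \<bullet> ?wx = 0"
    by (simp add: inner_hermitian_skew skew_mult_self skew)
  moreover have "2 * (?p \<bullet> (?g ** ?wxx)) = - (?a \<bullet> ?wxx)"
    by (simp add: inner_mult_adjoint_left \<gamma>_skew A_def mat_distribs)
  ultimately have 1: "?p \<bullet> wt x t = - (?a \<bullet> ?wxx) + 2 * (?p \<bullet> (?w ** ?r))"
    unfolding wt_eq by (simp add: inner_add_right)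
  have cubic: "(?p ** ?p) \<bullet> (?r ** ?p) = - ((?p ** (?p ** ?p)) \<bullet> ?r)"
      "(?p ** ?p) \<bullet> (?p ** ?r) = - ((?p ** (?p ** ?p)) \<bullet> ?r)"
    by (simp_all add: inner_mult_adjoint_left[of "?p ** ?p" ?p ?r] inner_mult_adjoint_right[of "?p ** ?p" ?r ?p]
        skew mat_algebra)
  \<comment> \<open>Moving \<open>\<gamma>\<close> across \<open>r\<close> produces the cubic term;
    the leftover equals its own negative because \<open>p\<close> and \<open>\<gamma>\<close>
    anticommute.\<close>
  have 2: "(?g ** (?r ** ?p)) \<bullet> ?r = - 2 * ((?p ** (?p ** ?p)) \<bullet> ?r)"
  proof -
    have "(?g ** (?r ** ?p)) \<bullet> ?r = - ((?r ** ?p) \<bullet> (?g ** ?r))"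
      using inner_mult_adjoint_left[of ?r ?g "?r ** ?p"] by (simp add: \<gamma>_skew mat_distribs inner_commute)
    also have "?g ** ?r = - 2 *\<^sub>R (?p ** ?p) - ?r ** ?g" by (simp add: r\<gamma>)
    also have "- ((?r ** ?p) \<bullet> \<dots>) = 2 * ((?p ** ?p) \<bullet> (?r ** ?p)) + (?r ** ?p) \<bullet> (?r ** ?g)"
      by (simp add: inner_diff_right inner_commute)
    also have "(?r ** ?p) \<bullet> (?r ** ?g) = 0"
    proof -
      have "(?r ** ?p) \<bullet> (?r ** ?g) = - ((?r ** (?p ** ?g)) \<bullet> ?r)"
        by (simp add: inner_mult_adjoint_right[of "?r ** ?p" ?r ?g] \<gamma>_skew mat_algebra)
      moreover have "(?r ** ?g) \<bullet> (?r ** ?p) = - ((?r ** (?g ** ?p)) \<bullet> ?r)"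
        by (simp add: inner_mult_adjoint_right[of "?r ** ?g" ?r ?p] skew mat_algebra)
      ultimately show ?thesis by (simp add: p\<gamma> mat_distribs inner_commute)
    qed
    finally show ?thesis using cubic by simp
  qed
  have "?p \<bullet> (?w ** ?r) = - ((?w ** ?p) \<bullet> ?r)"
    by (simp add: inner_mult_adjoint_left skew mat_distribs)
  also have "\<dots> = 2 * ((?p ** (?p ** ?p)) \<bullet> ?r)"
    unfolding w_eq using 2 by (simp add: mat_algebra inner_add_left)
  finally have "?d = ft x t"
    unfolding ft_def 1 using cubic by (simp add: inner_add_right inner_commute)
  then show ?thesis using d by (simp add: has_real_derivative_iff_has_vector_derivative)
qed

end

section \<open>Energy near minus infinity\<close>

lemma integral_param_has_vector_derivative:
  fixes f fx :: "real \<Rightarrow> real \<Rightarrow> 'a::banach"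
  assumes d: "\<And>x t. ((\<lambda>y. f y t) has_vector_derivative fx x t) (at x)"
    and f: "\<And>x. continuous_on UNIV (f x)"
    and fx: "continuous_on UNIV (\<lambda>z. fx (fst z) (snd z))"
  shows "((\<lambda>x. integral {a..b} (f x)) has_vector_derivative integral {a..b} (fx x)) (at x)"
  using leibniz_rule_vector_derivative[of UNIV a b f fx x] d
    integrable_continuous_interval[OF continuous_on_subset[OF f], of a b]
    continuous_on_subset[OF fx, of "UNIV \<times> cbox a b"]
  by (simp add: case_prod_beta)

lemma integral_param_continuous:
  fixes f :: "real \<Rightarrow> real \<Rightarrow> 'a::banach"
  assumes "continuous_on UNIV (\<lambda>z. f (fst z) (snd z))"
  shows "continuous_on S (\<lambda>x. integral {a..b} (f x))"
  using integral_continuous_on_param[of S a b f] continuous_on_subset[OF assms, of "S \<times> cbox a b"]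
  by (simp add: case_prod_beta)

lemma integral_swap_interval:
  fixes f :: "real \<Rightarrow> real \<Rightarrow> 'a::banach"
  assumes "continuous_on UNIV (\<lambda>z. f (fst z) (snd z))"
  shows "integral {a..b} (\<lambda>x. integral {c..d} (f x)) = integral {c..d} (\<lambda>y. integral {a..b} (\<lambda>x. f x y))"
  using integral_swap_continuous[of a c b d f] continuous_on_subset[OF assms, of "cbox (a,c) (b,d)"]
  by (simp add: case_prod_beta)

lemma integral_upper_has_real_derivative:
  fixes f :: "real \<Rightarrow> real"
  assumes "continuous_on UNIV f" "y > 0"
  shows "((\<lambda>y. integral {0..y} f) has_real_derivative f y) (at y)"
proof -
  have "((\<lambda>y. integral {0..y} f) has_real_derivative f y) (at y within {0..y+1})"
    using assms by (intro integral_has_real_derivative continuous_on_subset[OF assms(1)]) auto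
  then show ?thesis using assms(2) by (simp add: at_within_Icc_at)
qed

text \<open>The half line towards minus infinity is parametrised by z = -x, so that integrals run
  over [0, y].\<close>

lemma has_integral_reflected_derivative:
  fixes f :: "real \<Rightarrow> 'a::banach"
  assumes "\<And>x. (f has_vector_derivative f' x) (at x)" "0 \<le> y"
  shows "((\<lambda>z. f' (- z)) has_integral f 0 - f (- y)) {0..y}"
proof -
  have "((\<lambda>z. - f (- z)) has_vector_derivative f' (- z)) (at z within {0..y})" for z
  proof -
    have "((\<lambda>z. f (- z)) has_vector_derivative (- 1) *\<^sub>R f' (- z)) (at z)"
      using vector_diff_chain_at[of uminus "-1" z f "f' (- z)"] assms(1)
        has_vector_derivative_minus[OF has_vector_derivative_id]
      by (simp add: o_def)
    then show ?thesis
      using has_vector_derivative_minus has_vector_derivative_at_within by fastforce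
  qed
  from fundamental_theorem_of_calculus[OF assms(2) this] show ?thesis by simp
qed

lemma integrable_of_continuous: "continuous_on UNIV f \<Longrightarrow> f integrable_on {a..b::real}"
  for f :: "real \<Rightarrow> 'a::banach"
  using integrable_continuous_interval continuous_on_subset by blast

lemma has_integral_integral_continuous:
  fixes f :: "real \<Rightarrow> 'a::banach"
  shows "continuous_on UNIV f \<Longrightarrow> (f has_integral integral {a..b} f) {a..b}"
  by (intro integrable_integral integrable_of_continuous)

lemma two_mult_le_weighted_squares:
  fixes a b \<mu> :: real
  assumes "\<mu> > 0"
  shows "2 * (a * b) \<le> \<mu> * a\<^sup>2 + b\<^sup>2 / \<mu>"
proof -
  have "0 \<le> (\<mu> * a - b)\<^sup>2 / \<mu>" using assms by simp
  also have "\<dots> = \<mu> * a\<^sup>2 + b\<^sup>2 / \<mu> - 2 * (a * b)"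
    using assms by (simp add: power2_eq_square field_simps)
  finally show ?thesis by simp
qed

context gnls_flow
begin

lemma jointly_continuous:
  fixes u v :: "'z::topological_space \<Rightarrow> real"
  assumes "continuous_on S u" "continuous_on S v"
  shows "continuous_on S (\<lambda>z. pd i j \<gamma> (u z) (v z))"
  using continuous_on_compose2[OF pd_cont[of i j] continuous_on_Pair[OF assms]] by simp

lemma cont_\<gamma>:
  fixes u v :: "'z::topological_space \<Rightarrow> real"
  shows "continuous_on S u \<Longrightarrow> continuous_on S v \<Longrightarrow> continuous_on S (\<lambda>z. \<gamma> (u z) (v z))"
  using jointly_continuous[of S u v 0 0] by (simp add: pd_00)

lemmas conts = cont_\<gamma>
  jointly_continuous[of _ _ _ 1 0, folded p_def] jointly_continuous[of _ _ _ 2 0, folded r_def]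
  jointly_continuous[of _ _ _ 3 0, folded s_def] jointly_continuous[of _ _ _ 0 1, folded w_def]
  jointly_continuous[of _ _ _ 1 1, folded wx_def] jointly_continuous[of _ _ _ 2 1, folded wxx_def]
  jointly_continuous[of _ _ _ 0 2, folded wt_def]

lemmas cont_rules = conts mat_mult.continuous_on continuous_intros

lemma cont_A:
  fixes u v :: "'z::topological_space \<Rightarrow> real"
  shows "continuous_on S u \<Longrightarrow> continuous_on S v \<Longrightarrow> continuous_on S (\<lambda>z. A (u z) (v z))"
  unfolding A_def by (intro cont_rules)

text \<open>The constant belongs to a single time t; the lack of uniformity in t is the obstacle
  that this section overcomes.\<close>

lemma decay: "\<exists>C. \<forall>x. norm (p x t) \<le> C / (1 + x\<^sup>2) \<and> norm (p x t) \<le> C \<and> norm (w x t) \<le> C"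
proof -
  obtain C where C: "\<And>x. norm (p x t) * (1 + x\<^sup>2)\<^sup>2 \<le> C"
    using connection_decay[OF inCa[of t]] unfolding connection_eq norm_A by blast
  have "\<exists>D. \<forall>x. \<bar>x\<bar> ^ 0 * norm (vderivs 1 (vderivs 1 (\<lambda>x. \<gamma> x t)) x) \<le> D"
    using schwartz_C_a[OF inCa[of t]] unfolding schwartz_def by blast
  then obtain D where D: "\<And>x. norm (r x t) \<le> D"
    unfolding vderivs_Suc_shift[symmetric] vderivs_x r_def by (auto simp: numeral_2_eq_2)
  have p: "norm (p x t) \<le> C / (1 + x\<^sup>2)" "norm (p x t) \<le> C" for x
  proof -
    have pos: "0 < 1 + x\<^sup>2" by (simp add: add_pos_nonneg)
    have "norm (p x t) * (1 + x\<^sup>2) \<le> norm (p x t) * (1 + x\<^sup>2)\<^sup>2"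
      by (intro mult_left_mono self_le_power) auto
    then have le: "norm (p x t) * (1 + x\<^sup>2) \<le> C" using C[of x] by linarith
    then show "norm (p x t) \<le> C / (1 + x\<^sup>2)" using pos by (simp add: pos_le_divide_eq)
    have "norm (p x t) * 1 \<le> norm (p x t) * (1 + x\<^sup>2)" by (intro mult_left_mono) auto
    then show "norm (p x t) \<le> C" using le by simp
  qed
  have "norm (w x t) \<le> 2 * (C * C) + D" for x
  proof -
    have "norm (w x t) \<le> 2 * norm (p x t ** p x t) + norm (2 *\<^sub>R (\<gamma> x t ** r x t))"
      unfolding w_eq by (rule order.trans[OF norm_triangle_ineq]) simp
    also have "norm (p x t ** p x t) \<le> norm (p x t) * norm (p x t)" by (rule norm_mat_mult_le)
    also have "norm (p x t) * norm (p x t) \<le> C * C"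
      using p(2)[of x] by (intro mult_mono) (auto intro: order.trans[OF norm_ge_zero])
    also have "norm (2 *\<^sub>R (\<gamma> x t ** r x t)) \<le> D"
      unfolding norm_orbitM_mult[OF \<gamma>_orbit] by (rule D)
    finally show ?thesis by simp
  qed
  moreover have "0 \<le> C" using p(2)[of 0] norm_ge_zero order.trans by blast
  moreover have "0 \<le> D" using D[of 0] norm_ge_zero order.trans by blast
  ultimately have "norm (p x t) \<le> (C + 2 * (C * C) + D) / (1 + x\<^sup>2) \<and> norm (p x t) \<le> C + 2 * (C * C) + D
      \<and> norm (w x t) \<le> C + 2 * (C * C) + D" for x
  proof -
    assume C: "0 \<le> C" "0 \<le> D" and w: "\<And>x. norm (w x t) \<le> 2 * (C * C) + D"
    have CC: "0 \<le> C * C" by simp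
    have "C / (1 + x\<^sup>2) \<le> (C + 2 * (C * C) + D) / (1 + x\<^sup>2)"
      using C CC by (intro divide_right_mono) auto
    then show ?thesis using p[of x] w[of x] C CC by linarith
  qed
  then show ?thesis by blast
qed

text \<open>The energy on [-y, 0]. Being monotone in y, it is bounded as soon as it is bounded along
  a sequence of y tending to infinity.\<close>

definition M where "M y t = integral {0..y} (\<lambda>z. p (- z) t \<bullet> p (- z) t)"

lemma M_mono: "y \<le> y' \<Longrightarrow> M y t \<le> M y' t"
  unfolding M_def by (intro integral_subset_le integrable_of_continuous cont_rules) auto

lemma M_cont: "continuous_on S (M y)"
  unfolding M_def[abs_def] by (intro integral_param_continuous cont_rules)

lemma has_integral_arctan: "0 \<le> y \<Longrightarrow> ((\<lambda>z. 1 / (1 + z\<^sup>2)) has_integral arctan y) {0..y}"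
  using fundamental_theorem_of_calculus[of 0 y arctan "\<lambda>z. 1 / (1 + z\<^sup>2)"]
    has_field_derivative_at_within[OF DERIV_arctan]
  by (simp add: has_real_derivative_iff_has_vector_derivative[symmetric] inverse_eq_divide)

lemma M_finite: "\<exists>K. \<forall>y. M y t \<le> K"
proof -
  obtain C where C: "\<And>x. norm (p x t) \<le> C / (1 + x\<^sup>2)" "\<And>x. norm (p x t) \<le> C" using decay by blast
  have C0: "0 \<le> C" using C(2)[of 0] norm_ge_zero order.trans by blast
  have "M y t \<le> C * C * (pi / 2)" for y
  proof (cases "0 \<le> y")
    case True
    have "M y t \<le> integral {0..y} (\<lambda>z. C * C * (1 / (1 + z\<^sup>2)))"
      unfolding M_def
    proof (intro integral_le integrable_of_continuous cont_rules)
      fix z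
      have "p (- z) t \<bullet> p (- z) t = norm (p (- z) t) * norm (p (- z) t)"
        by (simp add: dot_square_norm power2_eq_square)
      also have "\<dots> \<le> C * (C / (1 + z\<^sup>2))" using C(1)[of "- z"] C(2)[of "- z"] C0 by (intro mult_mono) auto
      finally show "p (- z) t \<bullet> p (- z) t \<le> C * C * (1 / (1 + z\<^sup>2))" by simp
    qed (auto simp: add_nonneg_eq_0_iff)
    also have "\<dots> = C * C * arctan y"
      by (intro integral_unique has_integral_mult_right has_integral_arctan True)
    also have "\<dots> \<le> C * C * (pi / 2)" using arctan_ubound[of y] by (intro mult_left_mono) auto
    finally show ?thesis .
  next
    case False
    then show ?thesis by (simp add: M_def)
  qed
  then show ?thesis by blast
qed

lemma M_dt: "0 \<le> y \<Longrightarrow> ((\<lambda>t. M y t) has_real_derivative 2 * (p 0 t \<bullet> w 0 t) - 2 * (p (- y) t \<bullet> w (- y) t)) (at t)"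
proof -
  assume y: "0 \<le> y"
  have "((\<lambda>t. M y t) has_vector_derivative integral {0..y} (\<lambda>z. 2 * (p (- z) t \<bullet> wx (- z) t))) (at t)"
    unfolding M_def
    by (rule integral_param_has_vector_derivative[where fx = "\<lambda>t z. 2 * (p (- z) t \<bullet> wx (- z) t)"])
      (auto intro!: cont_rules mass_dt simp: has_real_derivative_iff_has_vector_derivative[symmetric])
  moreover have "((\<lambda>z. p (- z) t \<bullet> wx (- z) t) has_integral p 0 t \<bullet> w 0 t - p (- y) t \<bullet> w (- y) t) {0..y}"
    using y mass_law by (intro has_integral_reflected_derivative)
      (auto simp: has_real_derivative_iff_has_vector_derivative[symmetric])
  ultimately show ?thesis
    by (simp add: has_real_derivative_iff_has_vector_derivative integral_unique algebra_simps)
qed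

section \<open>Fluxes integrated over a time interval\<close>

definition H where "H a b x = integral {a..b} (h x)"
definition flux where "flux a b x = integral {a..b} (\<lambda>t. p x t \<bullet> w x t)"
definition crossnorm where "crossnorm a b x = integral {a..b} (\<lambda>t. norm (p x t) * norm (w x t))"

lemma abs_flux_le: "\<bar>flux a b x\<bar> \<le> crossnorm a b x"
proof -
  have "norm (flux a b x) \<le> crossnorm a b x"
    unfolding flux_def crossnorm_def
    by (intro integral_norm_bound_integral integrable_of_continuous cont_rules)
      (simp add: Cauchy_Schwarz_ineq2)
  then show ?thesis by simp
qed

lemma crossnorm_le:
  assumes "\<mu> > 0"
  shows "2 * crossnorm a b x \<le> \<mu> * integral {a..b} (\<lambda>t. p x t \<bullet> p x t) + integral {a..b} (\<lambda>t. w x t \<bullet> w x t) / \<mu>"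
proof -
  have "((\<lambda>t. 2 * (norm (p x t) * norm (w x t))) has_integral 2 * crossnorm a b x) {a..b}"
    unfolding crossnorm_def by (intro has_integral_mult_right has_integral_integral_continuous cont_rules)
  moreover have "((\<lambda>t. \<mu> * (p x t \<bullet> p x t) + (w x t \<bullet> w x t) / \<mu>) has_integral
    \<mu> * integral {a..b} (\<lambda>t. p x t \<bullet> p x t) + integral {a..b} (\<lambda>t. w x t \<bullet> w x t) / \<mu>) {a..b}"
    by (intro has_integral_add has_integral_mult_right has_integral_divide has_integral_integral_continuous cont_rules)
  ultimately show ?thesis
    by (rule has_integral_le) (use two_mult_le_weighted_squares[OF assms] in \<open>simp add: dot_square_norm\<close>)
qed

text \<open>By \<open>momentum_law\<close> the integrand of the derivative is itself a time
  derivative, so only the two end times survive.\<close>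

lemma H_dx:
  assumes "a \<le> b"
  shows "(H a b has_real_derivative p x b \<bullet> w x b - p x a \<bullet> w x a) (at x)"
proof -
  have "(H a b has_vector_derivative integral {a..b} (ft x)) (at x)"
    unfolding H_def[abs_def]
  proof (rule integral_param_has_vector_derivative)
    show "((\<lambda>y. h y t) has_vector_derivative ft x t) (at x)" for x t
      using momentum_law by (simp add: has_real_derivative_iff_has_vector_derivative)
  qed (unfold h_def ft_def, (intro cont_rules cont_A)+)
  moreover have "(ft x has_integral p x b \<bullet> w x b - p x a \<bullet> w x a) {a..b}"
    using assms has_field_derivative_at_within[OF flux_dt]
    by (intro fundamental_theorem_of_calculus) (auto simp: has_real_derivative_iff_has_vector_derivative[symmetric])
  ultimately show ?thesis
    by (simp add: has_real_derivative_iff_has_vector_derivative integral_unique)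
qed

text \<open>Decay at the two times a and b bounds the x-derivative by a multiple of
  \<open>1 / (1 + x^2)\<close>, and comparison with arctan gives the bound.\<close>

lemma H_bounded:
  assumes "a \<le> b"
  shows "\<exists>C. \<forall>x\<le>0. H a b x \<le> C"
proof -
  have "\<exists>C. \<forall>x. \<bar>p x t \<bullet> w x t\<bar> \<le> C / (1 + x\<^sup>2)" for t
  proof -
    obtain C where C: "\<And>x. norm (p x t) \<le> C / (1 + x\<^sup>2)" "\<And>x. norm (w x t) \<le> C" using decay by blast
    have "\<bar>p x t \<bullet> w x t\<bar> \<le> C * C / (1 + x\<^sup>2)" for x
    proof -
      have "\<bar>p x t \<bullet> w x t\<bar> \<le> norm (p x t) * norm (w x t)" by (rule Cauchy_Schwarz_ineq2)
      also have "\<dots> \<le> (C / (1 + x\<^sup>2)) * C"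
        by (intro mult_mono C order.trans[OF norm_ge_zero C(1)]) auto
      finally show ?thesis by simp
    qed
    then show ?thesis by blast
  qed
  then obtain C where C: "\<And>t x. \<bar>p x t \<bullet> w x t\<bar> \<le> C t / (1 + x\<^sup>2)" by metis
  define D where "D = C a + C b"
  have D0: "0 \<le> D" using C[of 0 a] C[of 0 b] by (simp add: D_def)
  have "H a b x \<le> H a b 0 + D * (pi / 2)" if "x \<le> 0" for x
  proof -
    have "H a b x + D * arctan x \<le> H a b 0 + D * arctan 0"
      using that
    proof (rule DERIV_nonneg_imp_nondecreasing)
      fix z
      have "((\<lambda>x. H a b x + D * arctan x) has_real_derivative
         (p z b \<bullet> w z b - p z a \<bullet> w z a) + D * (1 / (1 + z\<^sup>2))) (at z)"
        using DERIV_arctan[of z] by (intro DERIV_add H_dx assms DERIV_cmult) (simp add: inverse_eq_divide)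
      moreover have "0 \<le> (p z b \<bullet> w z b - p z a \<bullet> w z a) + D * (1 / (1 + z\<^sup>2))"
        using C[of z a] C[of z b] by (simp add: D_def add_divide_distrib)
      ultimately show "\<exists>d. ((\<lambda>x. H a b x + D * arctan x) has_real_derivative d) (at z) \<and> 0 \<le> d" by blast
    qed
    moreover have "- (pi / 2) * D \<le> arctan x * D" using arctan_lbound[of x] D0 by (intro mult_right_mono) auto
    ultimately show ?thesis by (simp add: mult.commute)
  qed
  then show ?thesis by blast
qed

text \<open>A one-dimensional Sobolev inequality, from \<open>norm_A\<close> and
  \<open>A_dx\<close>. The weight \<open>K\<close> in Young's inequality is chosen so that
  multiplying by the energy bound \<open>K\<close> restores coefficient 1 in front of the integral
  of |w|^2.\<close>

lemma sobolev_bound: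
  assumes K: "K > 0" "\<And>y. M y t \<le> K" and z: "0 \<le> z" "z \<le> y"
  shows "p (- z) t \<bullet> p (- z) t \<le> p 0 t \<bullet> p 0 t + K * K + integral {0..y} (\<lambda>z. w (- z) t \<bullet> w (- z) t) / K"
proof -
  have nA: "A x t \<bullet> A x t = p x t \<bullet> p x t" for x by (simp add: dot_square_norm norm_A)
  have "((\<lambda>x. A x t \<bullet> A x t) has_vector_derivative (A x t \<bullet> w x t + w x t \<bullet> A x t)) (at x)" for x
    by (intro bounded_bilinear.has_vector_derivative[OF bounded_bilinear_inner] A_dx)
  then have "((\<lambda>x. p x t \<bullet> p x t) has_vector_derivative 2 * (A x t \<bullet> w x t)) (at x)" for x
    unfolding nA by (simp add: inner_commute)
  from has_integral_neg[OF has_integral_reflected_derivative[OF this z(1)]]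
  have "((\<lambda>z. - (2 * (A (- z) t \<bullet> w (- z) t))) has_integral p (- z) t \<bullet> p (- z) t - p 0 t \<bullet> p 0 t) {0..z}"
    by simp
  moreover have "((\<lambda>z. K * (p (- z) t \<bullet> p (- z) t) + (w (- z) t \<bullet> w (- z) t) / K) has_integral
     K * M z t + integral {0..z} (\<lambda>z. w (- z) t \<bullet> w (- z) t) / K) {0..z}"
    unfolding M_def
    by (intro has_integral_add has_integral_mult_right has_integral_divide has_integral_integral_continuous cont_rules)
  ultimately have "p (- z) t \<bullet> p (- z) t - p 0 t \<bullet> p 0 t \<le> K * M z t + integral {0..z} (\<lambda>z. w (- z) t \<bullet> w (- z) t) / K"
  proof (rule has_integral_le)
    fix z
    have "- (2 * (A (- z) t \<bullet> w (- z) t)) \<le> 2 * (norm (A (- z) t) * norm (w (- z) t))"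
      using Cauchy_Schwarz_ineq2[of "A (- z) t" "w (- z) t"] by simp
    also have "\<dots> \<le> K * (p (- z) t \<bullet> p (- z) t) + (w (- z) t \<bullet> w (- z) t) / K"
      using two_mult_le_weighted_squares[OF K(1)] by (simp add: dot_square_norm norm_A)
    finally show "- (2 * (A (- z) t \<bullet> w (- z) t)) \<le> \<dots>" .
  qed
  moreover have "K * M z t \<le> K * K" using K by simp
  moreover have "integral {0..z} (\<lambda>z. w (- z) t \<bullet> w (- z) t) / K \<le> integral {0..y} (\<lambda>z. w (- z) t \<bullet> w (- z) t) / K"
    using K(1) z by (intro divide_right_mono integral_subset_le integrable_of_continuous cont_rules) auto
  ultimately show ?thesis by linarith
qed

text \<open>Supremum bound times energy. The coefficient 1 of the last integral is below the 2 in
  \<open>momentum_balance\<close>, so that integral can be absorbed there.\<close>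

lemma quartic_bound:
  assumes K: "K > 0" "\<And>y. M y t \<le> K" and y: "0 \<le> y"
  shows "integral {0..y} (\<lambda>z. (p (- z) t ** p (- z) t) \<bullet> (p (- z) t ** p (- z) t))
     \<le> K * (p 0 t \<bullet> p 0 t) + K * K * K + integral {0..y} (\<lambda>z. w (- z) t \<bullet> w (- z) t)"
proof -
  define S where "S = p 0 t \<bullet> p 0 t + K * K + integral {0..y} (\<lambda>z. w (- z) t \<bullet> w (- z) t) / K"
  have "0 \<le> integral {0..y} (\<lambda>z. w (- z) t \<bullet> w (- z) t)"
    by (intro integral_nonneg integrable_of_continuous cont_rules) auto
  then have S0: "0 \<le> S" using K(1) by (simp add: S_def)
  have "integral {0..y} (\<lambda>z. (p (- z) t ** p (- z) t) \<bullet> (p (- z) t ** p (- z) t))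
    \<le> integral {0..y} (\<lambda>z. S * (p (- z) t \<bullet> p (- z) t))"
  proof (intro integral_le integrable_of_continuous cont_rules)
    fix z assume z: "z \<in> {0..y}"
    let ?p = "p (- z) t"
    have "(?p ** ?p) \<bullet> (?p ** ?p) \<le> (norm ?p * norm ?p)\<^sup>2"
      unfolding dot_square_norm by (intro power_mono norm_mat_mult_le) auto
    also have "\<dots> = (?p \<bullet> ?p) * (?p \<bullet> ?p)" by (simp add: dot_square_norm power2_eq_square)
    also have "\<dots> \<le> S * (?p \<bullet> ?p)"
      using sobolev_bound[OF K, of z y] z unfolding S_def by (intro mult_right_mono) auto
    finally show "(?p ** ?p) \<bullet> (?p ** ?p) \<le> S * (?p \<bullet> ?p)" .
  qed
  also have "\<dots> = S * M y t" unfolding M_def by simp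
  also have "\<dots> \<le> S * K" using K(2) S0 by (intro mult_left_mono)
  also have "\<dots> = K * (p 0 t \<bullet> p 0 t) + K * K * K + integral {0..y} (\<lambda>z. w (- z) t \<bullet> w (- z) t)"
    using K(1) by (simp add: S_def algebra_simps)
  finally show ?thesis .
qed

text \<open>Pointwise, \<open>h\<close> plus the quartic term plus the x-derivative of
  \<open>A \<bullet> w\<close> is twice |w|^2; this is integrated over time and space.\<close>

lemma momentum_balance:
  assumes "0 \<le> y"
  shows "2 * integral {0..y} (\<lambda>z. integral {a..b} (\<lambda>t. w (- z) t \<bullet> w (- z) t)) =
    integral {0..y} (\<lambda>z. H a b (- z))
    + integral {0..y} (\<lambda>z. integral {a..b} (\<lambda>t. (p (- z) t ** p (- z) t) \<bullet> (p (- z) t ** p (- z) t)))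
    + (integral {a..b} (\<lambda>t. A 0 t \<bullet> w 0 t) - integral {a..b} (\<lambda>t. A (- y) t \<bullet> w (- y) t))"
proof -
  let ?k = "\<lambda>x. integral {a..b} (\<lambda>t. w x t \<bullet> w x t)"
  let ?v = "\<lambda>x. integral {a..b} (\<lambda>t. (p x t ** p x t) \<bullet> (p x t ** p x t))"
  let ?j' = "\<lambda>x. integral {a..b} (\<lambda>t. A x t \<bullet> wx x t + w x t \<bullet> w x t)"
  have "((\<lambda>x. integral {a..b} (\<lambda>t. A x t \<bullet> w x t)) has_vector_derivative ?j' x) (at x)" for x
    by (rule integral_param_has_vector_derivative[where f = "\<lambda>x t. A x t \<bullet> w x t"])
      (auto intro!: cont_rules cont_A bounded_bilinear.has_vector_derivative[OF bounded_bilinear_inner] A_dx dx)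
  from has_integral_reflected_derivative[OF this assms]
  have j: "((\<lambda>z. ?j' (- z)) has_integral
     integral {a..b} (\<lambda>t. A 0 t \<bullet> w 0 t) - integral {a..b} (\<lambda>t. A (- y) t \<bullet> w (- y) t)) {0..y}" by simp
  have pointwise: "2 * ?k x = H a b x + ?v x + ?j' x" for x
  proof -
    have "((\<lambda>t. h x t + (p x t ** p x t) \<bullet> (p x t ** p x t) + (A x t \<bullet> wx x t + w x t \<bullet> w x t)) has_integral
       H a b x + ?v x + ?j' x) {a..b}"
      unfolding H_def h_def
      by (intro has_integral_add has_integral_integral_continuous cont_rules cont_A)
    then have "((\<lambda>t. 2 * (w x t \<bullet> w x t)) has_integral H a b x + ?v x + ?j' x) {a..b}"
      by (rule has_integral_eq[rotated]) (simp add: h_def)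
    moreover have "((\<lambda>t. 2 * (w x t \<bullet> w x t)) has_integral 2 * ?k x) {a..b}"
      by (intro has_integral_mult_right has_integral_integral_continuous cont_rules)
    ultimately show ?thesis by (rule has_integral_unique[rotated])
  qed
  have c: "continuous_on UNIV (\<lambda>z. H a b (- z))" "continuous_on UNIV (\<lambda>z. ?v (- z))" "continuous_on UNIV (\<lambda>z. ?k (- z))"
    unfolding H_def h_def by (intro integral_param_continuous cont_rules cont_A)+
  have "((\<lambda>z. H a b (- z) + ?v (- z) + ?j' (- z)) has_integral
     integral {0..y} (\<lambda>z. H a b (- z)) + integral {0..y} (\<lambda>z. ?v (- z))
      + (integral {a..b} (\<lambda>t. A 0 t \<bullet> w 0 t) - integral {a..b} (\<lambda>t. A (- y) t \<bullet> w (- y) t))) {0..y}"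
    using c by (intro has_integral_add j has_integral_integral_continuous)
  moreover have "((\<lambda>z. 2 * ?k (- z)) has_integral 2 * integral {0..y} (\<lambda>z. ?k (- z))) {0..y}"
    using c by (intro has_integral_mult_right has_integral_integral_continuous)
  ultimately show ?thesis
    unfolding pointwise by (rule has_integral_unique[rotated])
qed

text \<open>\<open>flux_liminf_zero\<close> applied to the space-time integrals of |p|^2 and |w|^2.
  The bound \<open>K\<close> provides its hypotheses but does not influence \<delta>.\<close>

lemma flux_small:
  assumes ab: "a \<le> b" and K: "K > 0" "\<And>y t. t \<in> {a..b} \<Longrightarrow> M y t \<le> K" and \<delta>: "\<delta> > 0" and Y: "Y > 0"
  shows "\<exists>y\<ge>Y. \<bar>flux a b (- y)\<bar> < \<delta>"
proof -
  let ?\<rho> = "\<lambda>x. integral {a..b} (\<lambda>t. p x t \<bullet> p x t)"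
  let ?k = "\<lambda>x. integral {a..b} (\<lambda>t. w x t \<bullet> w x t)"
  let ?v = "\<lambda>x. integral {a..b} (\<lambda>t. (p x t ** p x t) \<bullet> (p x t ** p x t))"
  define P where "P y = integral {0..y} (\<lambda>z. ?\<rho> (- z))" for y
  define m where "m y = integral {0..y} (\<lambda>z. ?k (- z))" for y
  have P: "P y \<le> K * (b - a)" for y
  proof -
    have "P y = integral {a..b} (M y)"
      unfolding P_def M_def[abs_def] by (intro integral_swap_interval cont_rules)
    also have "\<dots> \<le> integral {a..b} (\<lambda>t. K)"
      by (intro integral_le integrable_of_continuous M_cont K(2)) auto
    finally show ?thesis using ab by (simp add: mult.commute)
  qed
  have m_swap: "m y = integral {a..b} (\<lambda>t. integral {0..y} (\<lambda>z. w (- z) t \<bullet> w (- z) t))" for y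
    unfolding m_def by (intro integral_swap_interval cont_rules)
  obtain C where C: "\<And>x. x \<le> 0 \<Longrightarrow> H a b x \<le> C" using H_bounded[OF ab] by blast
  define D where "D = integral {a..b} (\<lambda>t. K * (p 0 t \<bullet> p 0 t) + K * K * K)"
  \<comment> \<open>The momentum balance bounds \<open>2 * m y\<close> by a linear term, the
    boundary terms and the quartic integral, which costs one \<open>m y\<close>; the boundary term
    at -y is the quantity to be shown small.\<close>
  have m_le: "m y \<le> (D + integral {a..b} (\<lambda>t. A 0 t \<bullet> w 0 t)) + C * y + crossnorm a b (- y)" if y: "0 \<le> y" for y
  proof -
    have "continuous_on UNIV (\<lambda>z. H a b (- z))"
      unfolding H_def h_def by (intro integral_param_continuous cont_rules cont_A)
    then have "integral {0..y} (\<lambda>z. H a b (- z)) \<le> integral {0..y} (\<lambda>z. C)"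
      by (intro integral_le integrable_of_continuous C) (auto intro: continuous_intros)
    then have 1: "integral {0..y} (\<lambda>z. H a b (- z)) \<le> C * y" using y by (simp add: mult.commute)
    have "integral {0..y} (\<lambda>z. ?v (- z)) =
       integral {a..b} (\<lambda>t. integral {0..y} (\<lambda>z. (p (- z) t ** p (- z) t) \<bullet> (p (- z) t ** p (- z) t)))"
      by (intro integral_swap_interval cont_rules)
    also have "\<dots> \<le> integral {a..b} (\<lambda>t. K * (p 0 t \<bullet> p 0 t) + K * K * K
        + integral {0..y} (\<lambda>z. w (- z) t \<bullet> w (- z) t))"
      by (intro integral_le integrable_of_continuous integral_param_continuous cont_rules quartic_bound K y)
    also have "\<dots> = D + m y"
      unfolding D_def m_swap
      by (intro integral_add integrable_of_continuous integral_param_continuous cont_rules)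
    finally have 2: "integral {0..y} (\<lambda>z. ?v (- z)) \<le> D + m y" .
    have "norm (integral {a..b} (\<lambda>t. A (- y) t \<bullet> w (- y) t)) \<le> crossnorm a b (- y)"
      unfolding crossnorm_def
      by (intro integral_norm_bound_integral integrable_of_continuous cont_rules cont_A)
        (metis Cauchy_Schwarz_ineq2 norm_A real_norm_def)
    then show ?thesis
      using momentum_balance[OF y, of a b] 1 2 unfolding m_def by simp
  qed
  have "\<exists>y\<ge>Y. crossnorm a b (- y) < \<delta>"
  proof (rule flux_liminf_zero[OF _ P _ _ m_le \<delta> Y])
    show "(P has_real_derivative ?\<rho> (- y)) (at y)" if "0 < y" for y
      unfolding P_def[abs_def] using that
      by (rule integral_upper_has_real_derivative[rotated]) (intro integral_param_continuous cont_rules)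
    show "(m has_real_derivative ?k (- y)) (at y)" if "0 < y" for y
      unfolding m_def[abs_def] using that
      by (rule integral_upper_has_real_derivative[rotated]) (intro integral_param_continuous cont_rules)
  qed (rule crossnorm_le)
  then show ?thesis using abs_flux_le order.strict_trans1 by blast
qed

lemma M_balance:
  assumes "a \<le> b" "0 \<le> y"
  shows "M y b - M y a = 2 * flux a b 0 - 2 * flux a b (- y)"
proof -
  have "((\<lambda>t. 2 * (p 0 t \<bullet> w 0 t) - 2 * (p (- y) t \<bullet> w (- y) t)) has_integral M y b - M y a) {a..b}"
    using assms has_field_derivative_at_within[OF M_dt[OF assms(2)]]
    by (intro fundamental_theorem_of_calculus) (auto simp: has_real_derivative_iff_has_vector_derivative[symmetric])
  moreover have "((\<lambda>t. 2 * (p 0 t \<bullet> w 0 t) - 2 * (p (- y) t \<bullet> w (- y) t)) has_integral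
     2 * flux a b 0 - 2 * flux a b (- y)) {a..b}"
    unfolding flux_def
    by (intro has_integral_diff has_integral_mult_right has_integral_integral_continuous cont_rules)
  ultimately show ?thesis by (rule has_integral_unique)
qed

text \<open>The bound \<open>K\<close> only guarantees some far point with small flux. Moving from y
  out to that point is harmless by monotonicity, so \<open>K\<close> does not appear in the
  conclusion. The two cases of \<open>ends\<close> are the two directions of time.\<close>

lemma M_propagation:
  assumes bound: "\<And>y \<tau>. \<tau> \<in> {a..b} \<Longrightarrow> M y \<tau> \<le> K" and "a \<le> b"
    and ends: "(\<sigma> = a \<and> \<tau> = b) \<or> (\<sigma> = b \<and> \<tau> = a)" and N: "\<And>y. M y \<sigma> \<le> N"
  shows "M y \<tau> \<le> N + 2 * \<bar>flux a b 0\<bar> + 1"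
proof -
  have "\<exists>y'\<ge>max y 1. \<bar>flux a b (- y')\<bar> < 1/2"
  proof (rule flux_small[OF assms(2)])
    show "0 < max K 1" by simp
    show "\<And>y t. t \<in> {a..b} \<Longrightarrow> M y t \<le> max K 1" using bound by (simp add: max.coboundedI1)
  qed auto
  then obtain y' where y': "y' \<ge> y" "0 \<le> y'" "\<bar>flux a b (- y')\<bar> < 1/2" by auto
  have "M y \<tau> \<le> M y' \<tau>" by (rule M_mono[OF y'(1)])
  then show ?thesis using M_balance[OF assms(2) y'(2)] y'(3) N[of y'] ends by auto
qed

theorem M_locally_bounded: "\<exists>K. \<forall>y. \<forall>t\<in>{a..b}. M y t \<le> K"
proof (rule propagation_imp_locally_bounded[OF M_cont M_finite])
  fix a b :: real
  \<comment> \<open>One constant must serve all pairs of times in [a, b], so the flux through x = 0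
    is bounded by the integral of its absolute value over the whole interval.\<close>
  define L where "L = integral {a..b} (\<lambda>t. \<bar>p 0 t \<bullet> w 0 t\<bar>)"
  have L: "\<bar>flux c d 0\<bar> \<le> L" if "{c..d} \<subseteq> {a..b}" for c d
  proof -
    have "norm (flux c d 0) \<le> integral {c..d} (\<lambda>t. \<bar>p 0 t \<bullet> w 0 t\<bar>)"
      unfolding flux_def by (intro integral_norm_bound_integral integrable_of_continuous cont_rules) simp
    also have "\<dots> \<le> L"
      unfolding L_def by (intro integral_subset_le integrable_of_continuous cont_rules that) auto
    finally show ?thesis by simp
  qed
  have "M y t \<le> N + (2 * L + 1)"
    if "s \<in> {a..b}" "t \<in> {a..b}" "\<And>y \<tau>. \<tau> \<in> closed_segment s t \<Longrightarrow> M y \<tau> \<le> K" "\<And>y. M y s \<le> N" for s t K N y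
  proof -
    have "M y t \<le> N + 2 * \<bar>flux (min s t) (max s t) 0\<bar> + 1"
      by (rule M_propagation[of "min s t" "max s t" K s t N])
        (use that in \<open>auto simp: closed_segment_eq_real_ivl min_def max_def split: if_splits\<close>)
    moreover have "\<bar>flux (min s t) (max s t) 0\<bar> \<le> L"
      using that by (intro L) auto
    ultimately show ?thesis by linarith
  qed
  then show "\<exists>C. \<forall>s\<in>{a..b}. \<forall>t\<in>{a..b}. \<forall>K N. (\<forall>y. \<forall>\<tau>\<in>closed_segment s t. M y \<tau> \<le> K)
       \<longrightarrow> (\<forall>y. M y s \<le> N) \<longrightarrow> (\<forall>y. M y t \<le> N + C)"
    by blast
qed

end

section \<open>Time dependence of the frame\<close>

lemma norm_diff_le_of_vector_derivative:
  fixes f :: "real \<Rightarrow> 'a::banach"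
  assumes "\<And>z. (f has_vector_derivative f' z) (at z)" "\<And>z. z \<in> closed_segment x y \<Longrightarrow> norm (f' z) \<le> C"
  shows "norm (f y - f x) \<le> C * \<bar>y - x\<bar>"
proof -
  have C0: "0 \<le> C" using assms(2)[of x] norm_ge_zero order.trans by (metis ends_in_segment(1))
  have *: "norm (f b - f a) \<le> C * (b - a)" if "a \<le> b" "{a..b} \<subseteq> closed_segment x y" for a b
  proof -
    have "(f' has_integral f b - f a) (cbox a b)"
      using that(1) fundamental_theorem_of_calculus[of a b f f'] has_vector_derivative_at_within[OF assms(1)] by auto
    from has_integral_bound[OF C0 this] have "norm (f b - f a) \<le> C * measure lborel (cbox a b)"
      using assms(2) that(2) by (simp add: subset_iff)
    then show ?thesis using that(1) by simp
  qed
  show ?thesis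
    using *[of x y] *[of y x] by (cases "x \<le> y") (auto simp: closed_segment_eq_real_ivl norm_minus_commute)
qed

lemma uniform_partial_derivative:
  fixes f ft :: "real \<Rightarrow> real \<Rightarrow> 'a::banach"
  assumes d: "\<And>x t. (f x has_vector_derivative ft x t) (at t)"
    and c: "continuous_on UNIV (\<lambda>z. ft (fst z) (snd z))" and "\<epsilon> > 0"
  shows "\<exists>\<delta>>0. \<forall>t. \<bar>t - t0\<bar> < \<delta> \<longrightarrow> (\<forall>x\<in>{a..b}. norm (f x t - f x t0 - (t - t0) *\<^sub>R ft x t0) \<le> \<epsilon> * \<bar>t - t0\<bar>)"
proof -
  let ?S = "{a..b} \<times> {t0 - 1..t0 + 1}"
  have "uniformly_continuous_on ?S (\<lambda>z. ft (fst z) (snd z))"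
    by (intro compact_uniformly_continuous continuous_on_subset[OF c] compact_Times) auto
  then obtain d where d0: "d > 0" and uc: "\<And>z z'. z \<in> ?S \<Longrightarrow> z' \<in> ?S \<Longrightarrow> dist z' z < d \<Longrightarrow>
       dist (ft (fst z') (snd z')) (ft (fst z) (snd z)) < \<epsilon>"
    unfolding uniformly_continuous_on_def using \<open>\<epsilon> > 0\<close> by metis
  have "norm (f x t - f x t0 - (t - t0) *\<^sub>R ft x t0) \<le> \<epsilon> * \<bar>t - t0\<bar>"
    if t: "\<bar>t - t0\<bar> < min 1 d" and x: "x \<in> {a..b}" for x t
  proof -
    have "norm ((f x t - t *\<^sub>R ft x t0) - (f x t0 - t0 *\<^sub>R ft x t0)) \<le> \<epsilon> * \<bar>t - t0\<bar>"
    proof (rule norm_diff_le_of_vector_derivative)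
      show "((\<lambda>\<tau>. f x \<tau> - \<tau> *\<^sub>R ft x t0) has_vector_derivative ft x \<tau> - ft x t0) (at \<tau>)" for \<tau>
        by (auto intro!: derivative_eq_intros d)
      fix \<tau> assume "\<tau> \<in> closed_segment t0 t"
      then have "\<bar>\<tau> - t0\<bar> \<le> \<bar>t - t0\<bar>" by (auto simp: closed_segment_eq_real_ivl split: if_splits)
      then show "norm (ft x \<tau> - ft x t0) \<le> \<epsilon>"
        using uc[of "(x, t0)" "(x, \<tau>)"] t x by (simp add: dist_norm) linarith
    qed
    then show ?thesis by (simp add: algebra_simps)
  qed
  then show ?thesis using d0 by (intro exI[of _ "min 1 d"]) auto
qed

text \<open>A locally bounded x-derivative gives Lipschitz control in x that is locally uniform in
  t, which upgrades separate to joint continuity.\<close>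

lemma continuous_on_of_partial_derivative:
  fixes f fx :: "real \<Rightarrow> real \<Rightarrow> 'a::banach"
  assumes d: "\<And>x t. ((\<lambda>y. f y t) has_vector_derivative fx x t) (at x)"
    and bound: "\<And>x t. norm (fx x t) \<le> \<beta> (x, t)" and \<beta>: "continuous_on UNIV \<beta>"
    and c: "\<And>x. continuous_on UNIV (f x)"
  shows "continuous_on UNIV (\<lambda>z. f (fst z) (snd z))"
proof (rule continuous_at_imp_continuous_on, clarify)
  fix x0 t0 :: real
  let ?S = "{x0 - 1..x0 + 1} \<times> {t0 - 1..t0 + 1}"
  have "bounded (\<beta> ` ?S)"
    by (intro compact_imp_bounded compact_continuous_image continuous_on_subset[OF \<beta>] compact_Times) auto
  then obtain C where C: "\<And>z. z \<in> ?S \<Longrightarrow> \<bar>\<beta> z\<bar> \<le> C" by (auto simp: bounded_iff)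
  have est: "norm (f x t - f x0 t0) \<le> C * \<bar>x - x0\<bar> + norm (f x0 t - f x0 t0)" if "(x, t) \<in> ?S" for x t
  proof -
    have "norm (f x t - f x0 t) \<le> C * \<bar>x - x0\<bar>"
    proof (rule norm_diff_le_of_vector_derivative[OF d])
      fix z assume "z \<in> closed_segment x0 x"
      then have "(z, t) \<in> ?S" using that by (auto simp: closed_segment_eq_real_ivl split: if_splits)
      then show "norm (fx z t) \<le> C" using bound[of z t] C[of "(z, t)"] by linarith
    qed
    then show ?thesis using norm_triangle_ineq[of "f x t - f x0 t" "f x0 t - f x0 t0"] by simp
  qed
  have "((\<lambda>z. C * \<bar>fst z - x0\<bar> + norm (f x0 (snd z) - f x0 t0)) \<longlongrightarrow> C * \<bar>fst (x0, t0) - x0\<bar> + norm (f x0 (snd (x0, t0)) - f x0 t0)) (at (x0, t0))"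
    using c[of x0] by (intro tendsto_intros isCont_tendsto_compose[of _ "f x0"]) (simp_all add: continuous_on_eq_continuous_at)
  then have lim: "((\<lambda>z. C * \<bar>fst z - x0\<bar> + norm (f x0 (snd z) - f x0 t0)) \<longlongrightarrow> 0) (at (x0, t0))" by simp
  have "\<forall>\<^sub>F z in at (x0, t0). z \<in> {x0 - 1<..<x0 + 1} \<times> {t0 - 1<..<t0 + 1}"
    by (intro eventually_at_in_open' open_Times) auto
  then have "\<forall>\<^sub>F z in at (x0, t0). norm (f (fst z) (snd z) - f x0 t0) \<le> C * \<bar>fst z - x0\<bar> + norm (f x0 (snd z) - f x0 t0)"
    by eventually_elim (auto intro!: est)
  from Lim_null_comparison[OF this lim]
  show "isCont (\<lambda>z. f (fst z) (snd z)) (x0, t0)"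
    unfolding isCont_def by (simp add: LIM_zero_iff)
qed

context gnls_flow
begin

text \<open>The frame is picked for each t separately, so nothing is known about its dependence on
  t; regularity in t has to be earned.\<close>

definition G where "G x t = (SOME g. dev_frame (\<lambda>x. \<gamma> x t) g) x"

lemma G_frame: "dev_frame (\<lambda>x. \<gamma> x t) (\<lambda>x. G x t)"
  unfolding G_def using someI_ex[OF dev_frame_exists[OF inCa[of t]]] by simp

lemma G_unitary: "unitary (G x t)"
  using G_frame by (simp add: dev_frame_def)

lemma G_dx: "((\<lambda>y. G y t) has_vector_derivative A x t ** G x t) (at x)"
  using G_frame[of t] unfolding dev_frame_iff[OF inCa] connection_eq by blast

lemma G_lim: "((\<lambda>x. G x t) \<longlongrightarrow> mat 1) at_bot"
  using G_frame[of t] by (simp add: dev_frame_def)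

lemma \<gamma>_conj: "\<gamma> x t = G x t ** a_pt ** ctrans (G x t)"
  using G_frame[of t] by (simp add: dev_frame_def matrix_inv_unitary[OF G_unitary])

lemmas G_cancel = unitary_cancel[OF G_unitary]

text \<open>Parallel transport from x to y. The normalisation at minus infinity cancels, so it can
  be differentiated in t by arguments on a compact interval.\<close>

definition T where "T y x t = G y t ** ctrans (G x t)"

lemma T_unitary: "unitary (T y x t)"
  unfolding T_def by (intro unitary_mult unitary_ctrans G_unitary)

lemma T_self: "T x x t = mat 1"
  by (simp add: T_def G_cancel)

lemma T_dy: "((\<lambda>y. T y x t) has_vector_derivative A y t ** T y x t) (at y)"
  using has_vector_derivative_mat_mult[OF G_dx has_vector_derivative_const[of "ctrans (G x t)"], of t y]
  by (simp add: T_def mat_algebra)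

lemma T_dx: "((\<lambda>x. T y x t) has_vector_derivative - (T y x t ** A x t)) (at x)"
  using has_vector_derivative_mat_mult[OF has_vector_derivative_const[of "G y t"] has_vector_derivative_ctrans[OF G_dx], of t x]
  by (simp add: T_def mat_algebra ctrans_mult A_skew)

lemma cont_At:
  fixes u v :: "'z::topological_space \<Rightarrow> real"
  shows "continuous_on S u \<Longrightarrow> continuous_on S v \<Longrightarrow> continuous_on S (\<lambda>z. At (u z) (v z))"
  unfolding At_def by (intro cont_rules)

lemma cont_B:
  fixes u v :: "'z::topological_space \<Rightarrow> real"
  shows "continuous_on S u \<Longrightarrow> continuous_on S v \<Longrightarrow> continuous_on S (\<lambda>z. B (u z) (v z))"
  unfolding B_def by (intro cont_rules)

text \<open>By zero curvature the first-order Taylor remainder \<open>R\<close> of the transport satisfies the transport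
  equation up to an error of second order.\<close>

lemma T_dt: "((\<lambda>t. T y x t) has_vector_derivative B y t0 ** T y x t0 - T y x t0 ** B x t0) (at t0)"
proof -
  \<comment> \<open>The candidate for the t-derivative. It vanishes at z = x and solves the
    linearised transport equation \<open>E' = At T + A E\<close>.\<close>
  define E where "E z = B z t0 ** T z x t0 - T z x t0 ** B x t0" for z
  define E' where "E' z = At z t0 ** T z x t0 + A z t0 ** E z" for z
  have E_deriv: "(E has_vector_derivative E' z) (at z)" for z
  proof -
    have "(E has_vector_derivative (B z t0 ** (A z t0 ** T z x t0) + Bx z t0 ** T z x t0)
        - (T z x t0 ** 0 + (A z t0 ** T z x t0) ** B x t0)) (at z)"
      unfolding E_def[abs_def]
      by (intro has_vector_derivative_diff has_vector_derivative_mat_mult B_dx T_dy has_vector_derivative_const)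
    moreover have "(B z t0 ** (A z t0 ** T z x t0) + Bx z t0 ** T z x t0)
        - (T z x t0 ** 0 + (A z t0 ** T z x t0) ** B x t0) = E' z"
      unfolding E'_def E_def zero_curvature comm_def by (simp add: mat_algebra)
    ultimately show ?thesis by simp
  qed
  let ?a = "min x y" and ?b = "max x y"
  have "bounded (E ` {?a..?b})"
    using has_vector_derivative_continuous[OF E_deriv]
    by (intro compact_imp_bounded compact_continuous_image continuous_at_imp_continuous_on) auto
  then obtain e where e: "\<And>z. z \<in> {?a..?b} \<Longrightarrow> norm (E z) \<le> e" "e > 0"
    unfolding bounded_pos by blast
  have "bounded ((\<lambda>z. At z t0) ` {?a..?b})"
    by (intro compact_imp_bounded compact_continuous_image cont_At continuous_intros) auto
  then obtain l where l: "\<And>z. z \<in> {?a..?b} \<Longrightarrow> norm (At z t0) \<le> l" "l > 0"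
    unfolding bounded_pos by blast
  define c where "c = norm (mat 1 :: ('k, 'm) mat)"
  have c: "c \<ge> 0" "norm (T z x t) = c" for z t
    by (simp_all add: c_def norm_unitary[OF T_unitary])
  show ?thesis
    unfolding has_vector_derivative_def has_derivative_at_alt E_def[symmetric]
  proof (intro conjI allI impI bounded_linear_scaleR_left)
    fix \<epsilon> :: real assume "\<epsilon> > 0"
    \<comment> \<open>The factor \<open>c + 1\<close> pays for the two parts of \<open>R'\<close>
      and the other for the length of the segment; adding 1 keeps the denominator positive when x =
      y.\<close>
    define \<eta> where "\<eta> = \<epsilon> / ((\<bar>y - x\<bar> + 1) * (c + 1))"
    have \<eta>: "\<eta> > 0" using \<open>\<epsilon> > 0\<close> c(1) by (simp add: \<eta>_def add_nonneg_pos)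
    have "(\<bar>y - x\<bar> + 1) * (c + 1) \<noteq> 0" using c(1) by auto
    then have \<eta>_eq: "\<eta> * ((\<bar>y - x\<bar> + 1) * (c + 1)) = \<epsilon>"
      unfolding \<eta>_def by (rule nonzero_eq_divide_eq[THEN iffD1, OF _ refl])
    obtain d where d: "d > 0" "\<And>t z. \<bar>t - t0\<bar> < d \<Longrightarrow> z \<in> {?a..?b} \<Longrightarrow>
        norm (A z t - A z t0 - (t - t0) *\<^sub>R At z t0) \<le> \<eta> * \<bar>t - t0\<bar>"
      using uniform_partial_derivative[OF A_dt cont_At[OF continuous_on_fst[OF continuous_on_id] continuous_on_snd[OF continuous_on_id]] \<eta>] by blast
    \<comment> \<open>Makes the part of \<open>R'\<close> that is quadratic in \<open>t - t0\<close>
      at most \<open>\<eta>\<close> times |t - t0|.\<close>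
    define d' where "d' = min d (\<eta> / ((\<eta> + l) * e))"
    have "d' > 0" using d(1) \<eta> l(2) e(2) by (simp add: d'_def add_pos_pos)
    moreover have "norm (T y x t - T y x t0 - (t - t0) *\<^sub>R E y) \<le> \<epsilon> * norm (t - t0)"
      if t: "norm (t - t0) < d'" for t
    proof -
      let ?\<tau> = "\<bar>t - t0\<bar>"
      define R where "R z = T z x t - T z x t0 - (t - t0) *\<^sub>R E z" for z
      define R' where "R' z = (A z t - A z t0 - (t - t0) *\<^sub>R At z t0) ** T z x t0 + (t - t0) *\<^sub>R ((A z t - A z t0) ** E z)" for z
      have R: "(R has_vector_derivative A z t ** R z + R' z) (at z)" for z
      proof -
        have "(R has_vector_derivative A z t ** T z x t - A z t0 ** T z x t0 - (t - t0) *\<^sub>R E' z) (at z)"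
          unfolding R_def[abs_def]
          by (intro has_vector_derivative_diff T_dy E_deriv bounded_linear.has_vector_derivative[OF bounded_linear_scaleR_right])
        moreover have "A z t ** T z x t - A z t0 ** T z x t0 - (t - t0) *\<^sub>R E' z = A z t ** R z + R' z"
          by (simp add: R_def R'_def E'_def mat_algebra)
        ultimately show ?thesis by simp
      qed
      \<comment> \<open>Conjugating away the transport at time t removes the term
        \<open>A z t ** R z\<close>, so a mean value estimate replaces Gronwall's
        inequality.\<close>
      have U: "((\<lambda>z. ctrans (G z t) ** R z) has_vector_derivative ctrans (G z t) ** R' z) (at z)" for z
        using has_vector_derivative_mat_mult[OF has_vector_derivative_ctrans[OF G_dx[of t z]] R[of z]]
        by (simp add: ctrans_mult A_skew mat_algebra)
      have R'_le: "norm (R' z) \<le> \<eta> * (c + 1) * ?\<tau>" if z: "z \<in> closed_segment x y" for z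
      proof -
        have z: "z \<in> {?a..?b}" using z by (auto simp: closed_segment_eq_real_ivl split: if_splits)
        have td: "?\<tau> < d" "?\<tau> \<le> \<eta> / ((\<eta> + l) * e)" using t by (simp_all add: d'_def)
        have 1: "norm (A z t - A z t0 - (t - t0) *\<^sub>R At z t0) \<le> \<eta> * ?\<tau>" by (rule d(2)[OF td(1) z])
        have "norm (A z t - A z t0) \<le> norm (A z t - A z t0 - (t - t0) *\<^sub>R At z t0) + norm ((t - t0) *\<^sub>R At z t0)"
          using norm_triangle_ineq[of "A z t - A z t0 - (t - t0) *\<^sub>R At z t0" "(t - t0) *\<^sub>R At z t0"] by simp
        also have "\<dots> \<le> \<eta> * ?\<tau> + ?\<tau> * l" using 1 l(1)[OF z] by (simp add: add_mono mult_left_mono)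
        finally have 2: "norm (A z t - A z t0) \<le> (\<eta> + l) * ?\<tau>" by (simp add: algebra_simps)
        have "norm (R' z) \<le> norm ((A z t - A z t0 - (t - t0) *\<^sub>R At z t0) ** T z x t0) + ?\<tau> * norm ((A z t - A z t0) ** E z)"
          unfolding R'_def by (rule order.trans[OF norm_triangle_ineq]) simp
        also have "\<dots> \<le> (\<eta> * ?\<tau>) * c + ?\<tau> * (((\<eta> + l) * ?\<tau>) * e)"
          using 1 2 e(1)[OF z] c \<eta> l(2)
          by (intro add_mono mult_left_mono order.trans[OF norm_mat_mult_le] mult_mono) auto
        also have "?\<tau> * (((\<eta> + l) * ?\<tau>) * e) \<le> ?\<tau> * \<eta>"
        proof (rule mult_left_mono)
          have "0 < (\<eta> + l) * e" using \<eta> l(2) e(2) by simp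
          then have "?\<tau> * ((\<eta> + l) * e) \<le> \<eta>" using td(2) by (simp only: pos_le_divide_eq)
          then show "((\<eta> + l) * ?\<tau>) * e \<le> \<eta>" by (simp add: mult_ac)
        qed simp
        finally show ?thesis by (simp add: algebra_simps)
      qed
      have "norm (ctrans (G y t) ** R y - ctrans (G x t) ** R x) \<le> (\<eta> * (c + 1) * ?\<tau>) * \<bar>y - x\<bar>"
        using R'_le by (intro norm_diff_le_of_vector_derivative[OF U])
          (simp add: norm_unitary_mult[OF unitary_ctrans[OF G_unitary]])
      also have "R x = 0" by (simp add: R_def E_def T_self)
      finally have "norm (R y) \<le> (\<eta> * (c + 1) * ?\<tau>) * \<bar>y - x\<bar>"
        by (simp add: norm_unitary_mult[OF unitary_ctrans[OF G_unitary]] mat_distribs)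
      also have "\<dots> \<le> (\<eta> * (c + 1) * ?\<tau>) * (\<bar>y - x\<bar> + 1)"
        using \<eta> c(1) by (intro mult_left_mono) auto
      also have "\<dots> = \<epsilon> * ?\<tau>"
        unfolding \<eta>_eq[symmetric] by (simp only: mult_ac)
      finally show ?thesis by (simp add: R_def)
    qed
    ultimately show "\<exists>d>0. \<forall>t. norm (t - t0) < d \<longrightarrow> norm (T y x t - T y x t0 - (t - t0) *\<^sub>R E y) \<le> \<epsilon> * norm (t - t0)"
      by blast
  qed
qed

lemma T_cont: "continuous_on UNIV (\<lambda>z. T y (fst z) (snd z))"
proof (rule continuous_on_of_partial_derivative[OF T_dx])
  show "norm (- (T y x t ** A x t)) \<le> norm (A (fst (x, t)) (snd (x, t)))" for x t
    by (simp add: norm_unitary_mult[OF T_unitary])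
  show "continuous_on UNIV (\<lambda>z. norm (A (fst z) (snd z)))" by (intro cont_A continuous_intros)
  show "continuous_on UNIV (T y x)" for x
    using T_dt has_vector_derivative_continuous by (intro continuous_at_imp_continuous_on) blast
qed

lemma cont_T:
  fixes u v :: "'z::topological_space \<Rightarrow> real"
  assumes "continuous_on S u" "continuous_on S v" shows "continuous_on S (\<lambda>z. T y (u z) (v z))"
  using continuous_on_compose2[OF T_cont continuous_on_Pair[OF assms]] by simp

end

lemma conj_u_perp:
  assumes "unitary U" "X ** (U ** a_pt ** ctrans U) = - ((U ** a_pt ** ctrans U) ** X)" "ctrans X = - X"
  shows "ctrans U ** X ** U \<in> u_perp"
proof -
  note can = unitary_cancel[OF assms(1)]
  have "ctrans U ** (X ** (U ** a_pt ** ctrans U)) ** U = ctrans U ** - ((U ** a_pt ** ctrans U) ** X) ** U"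
    using assms(2) by simp
  then show ?thesis
    unfolding u_perp_iff by (simp add: ctrans_mult assms(3) mat_algebra can)
qed

section \<open>Moving the base point of the transport to minus infinity\<close>

context gnls_flow
begin

text \<open>The contribution of the base point x to the change of the transport; its disappearance
  as x tends to minus infinity is what has to be shown.\<close>

definition Z where "Z y a b x = integral {a..b} (\<lambda>t. T y x t ** B x t)"

lemma transport_increment:
  assumes "a \<le> b"
  shows "T y x b - T y x a = integral {a..b} (\<lambda>t. B y t ** T y x t) - Z y a b x"
proof -
  have "((\<lambda>t. B y t ** T y x t - T y x t ** B x t) has_integral T y x b - T y x a) {a..b}"
    by (intro fundamental_theorem_of_calculus assms has_vector_derivative_at_within[OF T_dt])
  moreover have "((\<lambda>t. B y t ** T y x t - T y x t ** B x t) has_integral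
     integral {a..b} (\<lambda>t. B y t ** T y x t) - Z y a b x) {a..b}"
    unfolding Z_def by (intro has_integral_diff has_integral_integral_continuous cont_rules cont_B cont_T)
  ultimately show ?thesis by (rule has_integral_unique)
qed

lemma T_lim: "((\<lambda>x. T y x t) \<longlongrightarrow> G y t) at_bot"
proof -
  have "((\<lambda>x. T y x t) \<longlongrightarrow> G y t ** ctrans (mat 1)) at_bot"
    unfolding T_def by (intro mat_mult.tendsto bounded_linear.tendsto[OF bounded_linear_ctrans] G_lim tendsto_const)
  then show ?thesis by simp
qed

text \<open>Dominated convergence: T is unitary, so \<open>norm (B y t)\<close> dominates. It also
  supplies integrability of the limit while continuity of \<open>G\<close> in t is still
  unknown.\<close>

lemma integral_BT_lim:
  shows "(\<lambda>t. B y t ** G y t) integrable_on {a..b}"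
    and "((\<lambda>x. integral {a..b} (\<lambda>t. B y t ** T y x t)) \<longlongrightarrow> integral {a..b} (\<lambda>t. B y t ** G y t)) at_bot"
proof -
  have seq: "(\<lambda>t. B y t ** G y t) integrable_on {a..b} \<and>
     (\<lambda>n. integral {a..b} (\<lambda>t. B y t ** T y (X n) t)) \<longlonglongrightarrow> integral {a..b} (\<lambda>t. B y t ** G y t)"
    if "filterlim X at_bot sequentially" for X
  proof -
    have 1: "(\<lambda>t. B y t ** T y (X n) t) integrable_on {a..b}" for n
      by (intro integrable_of_continuous cont_rules cont_B cont_T)
    have 2: "(\<lambda>t. norm (B y t)) integrable_on {a..b}"
      by (intro integrable_of_continuous cont_rules cont_B)
    have 3: "norm (B y t ** T y (X n) t) \<le> norm (B y t)" for n t
      by (simp add: norm_mult_unitary[OF T_unitary])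
    have 4: "(\<lambda>n. B y t ** T y (X n) t) \<longlonglongrightarrow> B y t ** G y t" for t
      by (intro mat_mult.tendsto tendsto_const filterlim_compose[OF T_lim that])
    show ?thesis
      using dominated_convergence[of "\<lambda>n t. B y t ** T y (X n) t", OF 1 2 3 4] by blast
  qed
  show "(\<lambda>t. B y t ** G y t) integrable_on {a..b}"
    using seq[of "\<lambda>n. - real n"] filterlim_real_sequentially by (simp add: filterlim_uminus_at_top)
  have "((\<lambda>z. integral {a..b} (\<lambda>t. B y t ** T y (- z) t)) \<longlongrightarrow> integral {a..b} (\<lambda>t. B y t ** G y t)) at_top"
    by (rule tendsto_at_topI_sequentially) (use seq in \<open>simp add: filterlim_uminus_at_top\<close>)
  then show "((\<lambda>x. integral {a..b} (\<lambda>t. B y t ** T y x t)) \<longlongrightarrow> integral {a..b} (\<lambda>t. B y t ** G y t)) at_bot"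
    by (simp add: filterlim_at_bot_mirror)
qed

text \<open>The x-derivative of \<open>T p\<close> is \<open>T r - 2 T \<gamma> p p\<close>; adding
  \<open>T B\<close>, where \<open>B\<close> is \<open>6 \<gamma> p p - r\<close>, leaves
  \<open>4 T \<gamma> p p\<close>.\<close>

lemma Z_decomposition:
  "((\<lambda>x. integral {a..b} (\<lambda>t. T y x t ** p x t)) has_vector_derivative
     4 *\<^sub>R integral {a..b} (\<lambda>t. T y x t ** (\<gamma> x t ** (p x t ** p x t))) - Z y a b x) (at x)"
proof -
  have d: "((\<lambda>x. T y x t ** p x t) has_vector_derivative T y x t ** r x t + (- (T y x t ** A x t)) ** p x t) (at x)" for x t
    by (intro has_vector_derivative_mat_mult T_dx dx)
  have "((\<lambda>x. integral {a..b} (\<lambda>t. T y x t ** p x t)) has_vector_derivative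
     integral {a..b} (\<lambda>t. T y x t ** r x t + (- (T y x t ** A x t)) ** p x t)) (at x)"
    by (rule integral_param_has_vector_derivative[OF d]) (intro cont_rules cont_T cont_A)+
  moreover have "((\<lambda>t. 4 *\<^sub>R (T y x t ** (\<gamma> x t ** (p x t ** p x t))) - T y x t ** B x t) has_integral
     4 *\<^sub>R integral {a..b} (\<lambda>t. T y x t ** (\<gamma> x t ** (p x t ** p x t))) - Z y a b x) {a..b}"
    unfolding Z_def
    by (intro has_integral_diff has_integral_cmul has_integral_integral_continuous cont_rules cont_T cont_B)
  moreover have "T y x t ** r x t + (- (T y x t ** A x t)) ** p x t =
     4 *\<^sub>R (T y x t ** (\<gamma> x t ** (p x t ** p x t))) - T y x t ** B x t" for t
    unfolding A_def B_def by (simp add: mat_algebra) (simp add: vec_eq_iff scaleR_conv_of_real)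
  ultimately show ?thesis by (simp add: integral_unique)
qed

text \<open>\<open>T B\<close> is an \<open>x\<close>-derivative up to a term quadratic in \<open>p\<close>. A nonzero limit of \<open>Z\<close> would therefore make
  \<open>N\<close> grow linearly, although \<open>N\<close> is controlled by the integrable function \<open>\<rho>\<close>.\<close>

lemma Z_lim_zero:
  assumes ab: "a \<le> b" and lim: "((\<lambda>x. Z y a b x) \<longlongrightarrow> v) at_bot"
  shows "v = 0"
proof (rule ccontr)
  assume "v \<noteq> 0"
  \<comment> \<open>Half of the limit of \<open>Z y a b x \<bullet> v\<close>, hence eventually a
    strict lower bound for it.\<close>
  define \<delta> where "\<delta> = (v \<bullet> v) / 2"
  have \<delta>: "\<delta> > 0" "\<delta> < v \<bullet> v" using \<open>v \<noteq> 0\<close> by (simp_all add: \<delta>_def)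
  obtain K where K: "\<And>y t. t \<in> {a..b} \<Longrightarrow> M y t \<le> K" using M_locally_bounded by blast
  define \<rho> where "\<rho> x = integral {a..b} (\<lambda>t. p x t \<bullet> p x t)" for x
  define P where "P z = integral {0..z} (\<lambda>z. \<rho> (- z))" for z
  have P_le: "P z \<le> K * (b - a)" for z
  proof -
    have "P z = integral {a..b} (M z)"
      unfolding P_def \<rho>_def M_def[abs_def] by (intro integral_swap_interval cont_rules)
    also have "\<dots> \<le> integral {a..b} (\<lambda>t. K)"
      by (intro integral_le integrable_of_continuous M_cont K) auto
    finally show ?thesis using ab by (simp add: mult.commute)
  qed
  have dP: "(P has_real_derivative \<rho> (- z)) (at z)" if "0 < z" for z
    unfolding P_def[abs_def] \<rho>_def using that
    by (rule integral_upper_has_real_derivative[rotated]) (intro integral_param_continuous cont_rules)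
  define N where "N x = integral {a..b} (\<lambda>t. T y x t ** p x t)" for x
  define Q where "Q x = integral {a..b} (\<lambda>t. T y x t ** (\<gamma> x t ** (p x t ** p x t)))" for x
  have N_dx: "(N has_vector_derivative 4 *\<^sub>R Q x - Z y a b x) (at x)" for x
    unfolding N_def[abs_def] Q_def by (rule Z_decomposition)
  have Q_le: "norm (Q x) \<le> \<rho> x" for x
    unfolding Q_def \<rho>_def
  proof (intro integral_norm_bound_integral integrable_of_continuous cont_rules cont_T)
    fix t
    have "norm (T y x t ** (\<gamma> x t ** (p x t ** p x t))) = norm (p x t ** p x t) / 2"
      by (simp add: norm_unitary_mult[OF T_unitary] norm_orbitM_mult'[OF \<gamma>_orbit])
    also have "\<dots> \<le> norm (p x t) * norm (p x t)"
      using norm_mat_mult_le[of "p x t" "p x t"] norm_ge_zero[of "p x t ** p x t"] by linarith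
    finally show "norm (T y x t ** (\<gamma> x t ** (p x t ** p x t))) \<le> p x t \<bullet> p x t"
      by (simp add: dot_square_norm power2_eq_square)
  qed
  have N_le: "norm (N x) \<le> (b - a) + \<rho> x" for x
  proof -
    have "norm (N x) \<le> integral {a..b} (\<lambda>t. 1 + p x t \<bullet> p x t)"
      unfolding N_def
    proof (intro integral_norm_bound_integral integrable_of_continuous cont_rules cont_T)
      fix t
      have "2 * norm (p x t) \<le> 1 + (norm (p x t))\<^sup>2"
        using two_mult_le_weighted_squares[of 1 1 "norm (p x t)"] by simp
      then have "norm (p x t) \<le> 1 + (norm (p x t))\<^sup>2"
        using norm_ge_zero[of "p x t"] by linarith
      then show "norm (T y x t ** p x t) \<le> 1 + p x t \<bullet> p x t"
        by (simp add: norm_unitary_mult[OF T_unitary] dot_square_norm)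
    qed
    also have "\<dots> = integral {a..b} (\<lambda>t. 1) + \<rho> x"
      unfolding \<rho>_def by (intro integral_add integrable_of_continuous cont_rules)
    finally show ?thesis using ab by simp
  qed
  have "((\<lambda>x. Z y a b x \<bullet> v) \<longlongrightarrow> v \<bullet> v) at_bot" by (intro tendsto_inner lim tendsto_const)
  then have "\<forall>\<^sub>F x in at_bot. \<delta> < Z y a b x \<bullet> v" using \<delta>(2) by (rule order_tendstoD(1))
  then obtain X where X: "\<And>x. x \<le> X \<Longrightarrow> \<delta> < Z y a b x \<bullet> v" unfolding eventually_at_bot_linorder by blast
  define Y where "Y = max 1 (- X)"
  \<comment> \<open>With this factor \<open>c * P\<close> compensates the quadratic term
    \<open>4 * Q\<close>, whose norm is at most \<open>4 * \<rho>\<close>.\<close>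
  define c where "c = 4 * norm v"
  have c0: "0 \<le> c" by (simp add: c_def)
  have nondec: "N (- Y) \<bullet> v + c * P Y - \<delta> * Y \<le> N (- z) \<bullet> v + c * P z - \<delta> * z" if "Y \<le> z" for z
    using that
  proof (rule DERIV_nonneg_imp_nondecreasing)
    fix z assume z: "Y \<le> z"
    have "((\<lambda>z. N (- z)) has_vector_derivative (- 1) *\<^sub>R (4 *\<^sub>R Q (- z) - Z y a b (- z))) (at z)"
      using vector_diff_chain_at[of uminus "-1" z N "4 *\<^sub>R Q (- z) - Z y a b (- z)"]
        has_vector_derivative_minus[OF has_vector_derivative_id] N_dx[of "- z"]
      by (simp add: o_def)
    from bounded_linear.has_vector_derivative[OF bounded_linear_inner_left this]
    have "((\<lambda>z. N (- z) \<bullet> v) has_real_derivative (Z y a b (- z) - 4 *\<^sub>R Q (- z)) \<bullet> v) (at z)"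
      by (simp add: has_real_derivative_iff_has_vector_derivative)
    then have "((\<lambda>z. N (- z) \<bullet> v + c * P z - \<delta> * z) has_real_derivative
        (Z y a b (- z) - 4 *\<^sub>R Q (- z)) \<bullet> v + c * \<rho> (- z) - \<delta>) (at z)"
      using z by (auto intro!: derivative_eq_intros dP simp: Y_def)
    moreover have "\<delta> < Z y a b (- z) \<bullet> v" using z by (intro X) (simp add: Y_def)
    moreover have "4 * (Q (- z) \<bullet> v) \<le> c * \<rho> (- z)"
    proof -
      have "Q (- z) \<bullet> v \<le> norm (Q (- z)) * norm v" by (rule norm_cauchy_schwarz)
      also have "\<dots> \<le> \<rho> (- z) * norm v" by (intro mult_right_mono Q_le) auto
      finally show ?thesis by (simp add: c_def mult.commute)
    qed
    ultimately show "\<exists>d. ((\<lambda>z. N (- z) \<bullet> v + c * P z - \<delta> * z) has_real_derivative d) (at z) \<and> 0 \<le> d"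
      by (intro exI[of _ "(Z y a b (- z) - 4 *\<^sub>R Q (- z)) \<bullet> v + c * \<rho> (- z) - \<delta>"]) (simp add: inner_diff_left)
  qed
  \<comment> \<open>An upper bound for \<open>\<delta> * z\<close> at any z beyond \<open>Y\<close>
    where \<rho> is below 1; such points exist arbitrarily far out because \<open>P\<close> is
    bounded.\<close>
  define E where "E = ((b - a) + 1) * norm v + c * (K * (b - a)) - (N (- Y) \<bullet> v + c * P Y - \<delta> * Y)"
  define W where "W = max Y (E / \<delta> + 1)"
  have "\<exists>z\<ge>W. \<rho> (- z) < 1"
    by (rule bounded_primitive_small[OF dP P_le]) (auto simp: W_def Y_def)
  then obtain z where z: "z \<ge> W" "\<rho> (- z) < 1" by blast
  have "N (- z) \<bullet> v \<le> norm (N (- z)) * norm v" by (rule norm_cauchy_schwarz)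
  also have "\<dots> \<le> ((b - a) + 1) * norm v"
    using N_le[of "- z"] z(2) by (intro mult_right_mono) auto
  finally have 1: "N (- z) \<bullet> v \<le> ((b - a) + 1) * norm v" .
  have 2: "c * P z \<le> c * (K * (b - a))" by (intro mult_left_mono P_le c0)
  have "E < \<delta> * z"
  proof -
    have "E / \<delta> < z" using z(1) by (simp add: W_def)
    then show ?thesis using \<delta>(1) by (simp add: pos_divide_less_eq mult.commute)
  qed
  moreover have "Y \<le> z" using z(1) by (simp add: W_def)
  ultimately show False using nondec[of z] 1 2 by (simp add: E_def)
qed

text \<open>In \<open>transport_increment\<close> every term other than \<open>Z\<close> converges,
  so \<open>Z\<close> has a limit and \<open>Z_lim_zero\<close> applies.\<close>

lemma G_increment:
  assumes "a \<le> b"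
  shows "G y b - G y a = integral {a..b} (\<lambda>t. B y t ** G y t)"
proof -
  have "((\<lambda>x. integral {a..b} (\<lambda>t. B y t ** T y x t) - (T y x b - T y x a)) \<longlongrightarrow>
      integral {a..b} (\<lambda>t. B y t ** G y t) - (G y b - G y a)) at_bot"
    by (intro tendsto_diff integral_BT_lim T_lim)
  then have "((\<lambda>x. Z y a b x) \<longlongrightarrow> integral {a..b} (\<lambda>t. B y t ** G y t) - (G y b - G y a)) at_bot"
    by (simp add: transport_increment[OF assms])
  from Z_lim_zero[OF assms this] show ?thesis by simp
qed

text \<open>The integral equation first shows that \<open>G\<close> is continuous in t; only then is
  the integrand continuous and the integral differentiable.\<close>

lemma G_dt: "((\<lambda>t. G y t) has_vector_derivative B y t ** G y t) (at t)"
proof -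
  let ?I = "{t - 1..t + 1}"
  have eq: "G y \<tau> = G y (t - 1) + integral {t - 1..\<tau>} (\<lambda>t. B y t ** G y t)" if "\<tau> \<in> ?I" for \<tau>
    using G_increment[of "t - 1" \<tau> y] that by (simp add: algebra_simps)
  have "continuous_on ?I (\<lambda>\<tau>. G y (t - 1) + integral {t - 1..\<tau>} (\<lambda>t. B y t ** G y t))"
    by (intro continuous_intros indefinite_integral_continuous_1 integral_BT_lim)
  then have "continuous_on ?I (G y)" by (rule continuous_on_eq) (rule eq[symmetric])
  then have "((\<lambda>\<tau>. integral {t - 1..\<tau>} (\<lambda>t. B y t ** G y t)) has_vector_derivative B y t ** G y t) (at t within ?I)"
    by (intro integral_has_vector_derivative mat_mult.continuous_on cont_B continuous_intros) auto
  then have "((\<lambda>\<tau>. G y (t - 1) + integral {t - 1..\<tau>} (\<lambda>t. B y t ** G y t)) has_vector_derivative 0 + B y t ** G y t) (at t within ?I)"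
    by (intro has_vector_derivative_add has_vector_derivative_const)
  then have "((\<lambda>\<tau>. G y \<tau>) has_vector_derivative 0 + B y t ** G y t) (at t within ?I)"
    by (rule has_vector_derivative_transform[OF _ eq, rotated 2]) auto
  then show ?thesis by (simp add: at_within_Icc_at)
qed

section \<open>The MNLS equation for the conjugated connection\<close>

lemma B_skew: "ctrans (B x t) = - B x t"
  unfolding B_def
  by (simp add: ctrans_diff ctrans_scaleR ctrans_mult skew \<gamma>_skew mat_algebra words)

lemma B_eq: "B x t = 2 *\<^sub>R (\<gamma> x t ** w x t) + 2 *\<^sub>R (\<gamma> x t ** (A x t ** A x t))"
  unfolding B_def A_def w_eq
  by (simp add: mat_algebra words) (simp add: vec_eq_iff scaleR_conv_of_real algebra_simps)

lemma w\<gamma>: "w x t ** \<gamma> x t = - (\<gamma> x t ** w x t)"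
  unfolding w_eq by (simp add: mat_algebra words)

definition u where "u x t = ctrans (G x t) ** A x t ** G x t"
definition ux where "ux x t = ctrans (G x t) ** w x t ** G x t"

lemma Phi_u: "Phi (\<lambda>y. \<gamma> y t) x = u x t"
  unfolding u_def using Phi_eq[OF inCa G_frame] unfolding connection_eq .

lemma conj_dx:
  assumes "(X has_vector_derivative X') (at x)"
  shows "((\<lambda>x. ctrans (G x t) ** X x ** G x t) has_vector_derivative
    ctrans (G x t) ** (X' + comm (X x) (A x t)) ** G x t) (at x)"
  using has_vector_derivative_mat_mult[OF has_vector_derivative_mat_mult[OF has_vector_derivative_ctrans[OF G_dx[of t x]] assms] G_dx[of t x]]
  by (simp add: ctrans_mult A_skew mat_algebra comm_def algebra_simps)

text \<open>The commutator produced by the moving frame is that of \<open>A\<close> with itself,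
  hence 0.\<close>

lemma u_dx: "((\<lambda>x. u x t) has_vector_derivative ux x t) (at x)"
  using conj_dx[OF A_dx[of t x], of t] by (simp add: u_def ux_def comm_def)

lemma u_dt: "((\<lambda>t. u x t) has_vector_derivative ctrans (G x t) ** (At x t + comm (A x t) (B x t)) ** G x t) (at t)"
  using has_vector_derivative_mat_mult[OF has_vector_derivative_mat_mult[OF has_vector_derivative_ctrans[OF G_dt[of x t]] A_dt[of x t]] G_dt[of x t]]
  by (simp add: u_def ctrans_mult B_skew mat_algebra comm_def algebra_simps)

text \<open>Conjugation by the frame turns \<open>\<gamma>\<close> into \<open>a_pt\<close>,
  \<open>A\<close> into \<open>u\<close> and \<open>w\<close> into \<open>ux\<close>, so
  \<open>B_eq\<close> becomes the formula of \<open>Q2_eq\<close>.\<close>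

lemma Q2_u: "Q2 (u x t) (ux x t) = ctrans (G x t) ** B x t ** G x t"
proof -
  have "A x t ** \<gamma> x t = - (\<gamma> x t ** A x t)"
    using connection_anticommute[OF inCa[of t], of x] unfolding connection_eq .
  then have perp: "u x t \<in> u_perp" "ux x t \<in> u_perp"
    unfolding u_def ux_def using w\<gamma>[of x t] skew(4)[of x t] A_skew[of x t]
    by (auto intro!: conj_u_perp[OF G_unitary] simp: \<gamma>_conj[symmetric])
  have conj: "ctrans (G x t) ** (\<gamma> x t ** X) = a_pt ** (ctrans (G x t) ** X)" for X
    by (subst \<gamma>_conj) (simp add: mat_algebra G_cancel)
  have "2 *\<^sub>R (a_pt ** ux x t) + 2 *\<^sub>R (a_pt ** (u x t ** u x t)) = ctrans (G x t) ** B x t ** G x t"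
    unfolding B_eq u_def ux_def by (simp add: mat_algebra conj G_cancel)
  then show ?thesis by (simp only: Q2_eq[OF perp])
qed

text \<open>By zero curvature \<open>u\<close> moves with the conjugate of \<open>Bx\<close>, while
  differentiating \<open>Q2\<close> in the moving frame adds the commutator of \<open>B\<close> with
  \<open>A\<close>; the difference is the conjugate of \<open>comm A B\<close>, which is the
  commutator of \<open>u\<close> with \<open>Q2\<close>.\<close>

lemma mnls:
  "((\<lambda>y. Q2 (u y t) (ux y t)) has_vector_derivative
      ctrans (G x t) ** (Bx x t + comm (B x t) (A x t)) ** G x t) (at x)"
  "((\<lambda>\<tau>. u x \<tau>) has_vector_derivative
      ctrans (G x t) ** (Bx x t + comm (B x t) (A x t)) ** G x t + comm (u x t) (Q2 (u x t) (ux x t))) (at t)"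
proof -
  show "((\<lambda>y. Q2 (u y t) (ux y t)) has_vector_derivative
      ctrans (G x t) ** (Bx x t + comm (B x t) (A x t)) ** G x t) (at x)"
    unfolding Q2_u by (rule conj_dx[OF B_dx])
  have "ctrans (G x t) ** (At x t + comm (A x t) (B x t)) ** G x t =
     ctrans (G x t) ** (Bx x t + comm (B x t) (A x t)) ** G x t + comm (u x t) (Q2 (u x t) (ux x t))"
    unfolding Q2_u zero_curvature
    by (simp add: u_def comm_def mat_algebra G_cancel)
  then show "((\<lambda>\<tau>. u x \<tau>) has_vector_derivative
      ctrans (G x t) ** (Bx x t + comm (B x t) (A x t)) ** G x t + comm (u x t) (Q2 (u x t) (ux x t))) (at t)"
    using u_dt[of x t] by simp
qed

end

theorem theorem3p10:
  fixes \<gamma> :: "real \<Rightarrow> real \<Rightarrow> ('k::finite, 'm::finite) mat"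
  assumes smooth: "smooth2 \<gamma>"
    and inCa: "\<And>t. (\<lambda>x. \<gamma> x t) \<in> C_a"
    and GNLS: "\<And>x t. ((\<lambda>s. \<gamma> x s) has_vector_derivative
                  comm (\<gamma> x t) (vderivs 2 (\<lambda>y. \<gamma> y t) x)) (at t)"
  defines "u \<equiv> \<lambda>x t. Phi (\<lambda>y. \<gamma> y t) x"
  shows "\<forall>x t. \<exists>D.
           ((\<lambda>y. Q2 (u y t) (vector_derivative (\<lambda>z. u z t) (at y))) has_vector_derivative D) (at x)
         \<and> ((\<lambda>s. u x s) has_vector_derivative
              D + comm (u x t) (Q2 (u x t) (vector_derivative (\<lambda>z. u z t) (at x)))) (at t)"
proof -
  interpret flow: gnls_flow \<gamma>
    by unfold_locales (fact smooth inCa GNLS)+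
  have u: "u = flow.u"
    by (simp add: u_def flow.Phi_u fun_eq_iff)
  have "vector_derivative (\<lambda>z. flow.u z t) (at y) = flow.ux y t" for y t
    by (rule vector_derivative_at) (rule flow.u_dx)
  then show ?thesis unfolding u using flow.mnls by (intro allI exI conjI) simp_all
qed

end
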